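(* Choose a number $N_S$ of alternative poles, i.e. of solutions $(\widetilde{E_i},\boldsymbol{a_i})$, $i=1,\dots,N_S$, of the Brune generalized eigenproblem $$\left[\boldsymbol{e}-\boldsymbol{\gamma}\left(\boldsymbol{S}(\widetilde{E_i})-\boldsymbol{B}\right)\boldsymbol{\gamma}^{\mathsf T}\right]\boldsymbol{a_i}=\widetilde{E_i}\,\boldsymbol{a_i},\qquad \boldsymbol{a_i}^{\mathsf T}\boldsymbol{a_i}=1,$$ and set $\boldsymbol{a}=[\boldsymbol{a_1},\dots,\boldsymbol{a_{N_S}}]$ and $\boldsymbol{\widetilde{\gamma}}=\boldsymbol{a}^{\mathsf T}\boldsymbol{\gamma}$. Define the alternative level matrix as the (Moore-Penrose) pseudo-inverse $$\boldsymbol{\widetilde{A}}=\left[\boldsymbol{a}^{\mathsf T}\boldsymbol{A}^{-1}\boldsymbol{a}\right]^{+}.$$ Then the choice of any number $N_S$ of alternative poles reconstructs the scattering matrix $\boldsymbol{U}(E)$ (that is, $\boldsymbol{U}(E)$ is obtained by replacing $\boldsymbol{\gamma}^{\mathsf T}\boldsymbol{A}\boldsymbol{\gamma}$ with $\boldsymbol{\widetilde{\gamma}}^{\mathsf T}\boldsymbol{\widetilde{A}}\boldsymbol{\widetilde{\gamma}}$ in its level-matrix expression) if, and only if, at least $N_\lambda$ solutions are chosen: $N_S\ge N_\lambda$.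
   Context: **R-matrix data.** There are $N_\lambda$ levels and $N_c$ channels. The Wigner-Eisenbud parameters are real: resonance energies $E_\lambda$ (pairwise different), widths $\gamma_{\lambda,c}$, boundary parameters $B_c$, thresholds $E_{T_c}$, channel radii $a_c$. Set $\boldsymbol{e}=\mathrm{diag}(E_\lambda)$, $\boldsymbol{\gamma}=(\gamma_{\lambda,c})\in\mathbb{R}^{N_\lambda\times N_c}$, $\boldsymbol{B}=\mathrm{diag}(B_c)$. For each channel, $\rho_c=k_ca_c$ is related to the energy by, for massive particles, $\rho_c(E)=\pm\rho_{0,c}\sqrt{E-E_{T_c}}$; $\boldsymbol{\rho}=\mathrm{diag}(\rho_c)$. The incoming and outgoing wave functions are $\boldsymbol{I}=\mathrm{diag}(I_c)$, $\boldsymbol{O}=\mathrm{diag}(O_c)$: solutions of $u''+\left(1-\frac{2\eta_c}{\rho}-\frac{\ell_c(\ell_c+1)}{\rho^2}\right)u=0$ ($\eta_c=0$ for neutral particles, for which $O_\ell=\mathrm{i}\rho h^{(1)}_\ell(\rho)$), with $I_c(k_c)=[O_c(k_c^* )]^*$ and Wronskian $O_c^{(1)}I_c-I_c^{(1)}O_c=2\mathrm{i}$. Moreover $\boldsymbol{L}=\mathrm{diag}(L_c)$ with $L_c=\frac{\rho_c}{O_c}\frac{\partial O_c}{\partial\rho_c}$. **Level matrix and scattering matrix.** The level matrix $\boldsymbol{A}(E)$ is defined by $\boldsymbol{A}^{-1}=\boldsymbol{e}-E\,\boldsymbol{1}-\boldsymbol{\gamma}(\boldsymbol{L}-\boldsymbol{B})\boldsymbol{\gamma}^{\mathsf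 T}$, and the scattering matrix is $$\boldsymbol{U}=\boldsymbol{O}^{-1}\boldsymbol{I}+2\mathrm{i}\,\boldsymbol{\rho}^{1/2}\boldsymbol{O}^{-1}\boldsymbol{\gamma}^{\mathsf T}\boldsymbol{A}\boldsymbol{\gamma}\,\boldsymbol{O}^{-1}\boldsymbol{\rho}^{1/2}.$$ **Shift function and alternative poles.** $\boldsymbol{S}=\mathrm{diag}(S_c)$ is the shift function, defined either by $S_c(E)=\Re[L_c(\rho_c(E))]$ (in which case solutions live on the sheets given by the choice of sign in $\rho_c(E)$ for each channel) or by analytic continuation $S_c(\rho_c)=\frac{L_c(\rho_c)+[L_c(\rho_c^* )]^*}{2}$. The theorem is meant for both conventions. The total number of solutions of the eigenproblem is in general at least $N_\lambda$ and possibly infinite; a finite number $N_S$ of different solutions among them is chosen, giving $\boldsymbol{a}$ of size $N_\lambda\times N_S$. In the original definition, $\boldsymbol{a}$ was square ($N_S=N_\lambda$) and $\boldsymbol{\widetilde{A}}^{-1}=\boldsymbol{a}^{\mathsf T}\boldsymbol{A}^{-1}\boldsymbol{a}$.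
   Formalization: Two assumptions are added, without which the claim fails: every level has a nonzero width in some channel, and, whenever at least as many poles as levels are chosen, the chosen eigenvectors span (the matrix a has rank N_λ). *)

theory Defs
  imports "HOL-Analysis.Analysis"
begin

definition diag_mat :: "('n \<Rightarrow> complex) \<Rightarrow> complex^'n^'n" where
  "diag_mat v = (\<chi> i j. if i = j then v i else 0)"

definition conj_transpose :: "complex^'n^'m \<Rightarrow> complex^'m^'n" where
  "conj_transpose A = (\<chi> i j. cnj (A $ j $ i))"

definition is_moore_penrose :: "complex^'n^'m \<Rightarrow> complex^'m^'n \<Rightarrow> bool" where
  "is_moore_penrose A P \<longleftrightarrow>
     A ** P ** A = A \<and> P ** A ** P = P \<and>
     conj_transpose (A ** P) = A ** P \<and> conj_transpose (P ** A) = P ** A"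

definition pinv :: "complex^'n^'m \<Rightarrow> complex^'m^'n" where
  "pinv A = (THE P. is_moore_penrose A P)"

text \<open>The spherical Hankel function of the first kind, in its terminating closed form;
  order 0 is \<open>- \<i> * exp (\<i> * z) / z\<close>.\<close>

definition spherical_hankel1 :: "nat \<Rightarrow> complex \<Rightarrow> complex" where
  "spherical_hankel1 l z =
     (- \<i>) ^ (l + 1) * exp (\<i> * z) / z *
     (\<Sum>m\<le>l. (\<i> ^ m / (fact m * (2 * z) ^ m)) * (fact (l + m) / fact (l - m)))"

text \<open>The index type \<open>'l\<close> is the set of levels and \<open>'c\<close> the set of channels.
  For channel \<open>c\<close> the Sommerfeld parameter at wave number \<open>k\<close> is \<open>eta_k d c / k\<close>
  (it is inversely proportional to the wave number), so \<open>eta_k d c = 0\<close> means neutral.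
  The function \<open>outgoing d c k\<close> is the outgoing wave at wave number \<open>k\<close> as a function
  of \<open>\<rho> = k * r\<close>; derivatives with respect to \<open>\<rho>\<close> are taken at fixed \<open>k\<close>,
  hence at fixed Sommerfeld parameter.\<close>

record ('l::finite, 'c::finite) rmatrix =
  res_energy :: "'l \<Rightarrow> real"
  width :: "real^'c^'l"
  boundary :: "'c \<Rightarrow> real"
  threshold :: "'c \<Rightarrow> real"
  radius :: "'c \<Rightarrow> real"
  rho0 :: "'c \<Rightarrow> real"
  ang_mom :: "'c \<Rightarrow> nat"
  eta_k :: "'c \<Rightarrow> real"
  outgoing :: "'c \<Rightarrow> complex \<Rightarrow> complex \<Rightarrow> complex"

definition incoming :: "('l::finite, 'c::finite) rmatrix \<Rightarrow> 'c \<Rightarrow> complex \<Rightarrow> complex \<Rightarrow> complex" where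
  "incoming d c k \<rho> = cnj (outgoing d c (cnj k) (cnj \<rho>))"

definition radial_solution :: "nat \<Rightarrow> complex \<Rightarrow> complex \<Rightarrow> (complex \<Rightarrow> complex) \<Rightarrow> bool" where
  "radial_solution l \<eta> k u \<longleftrightarrow>
     u analytic_on {k * of_real r |r. r > 0} \<and>
     (\<forall>r>0. let \<rho> = k * of_real r in
        deriv (deriv u) \<rho> + (1 - 2 * \<eta> / \<rho> - of_nat (l * (l + 1)) / \<rho>\<^sup>2) * u \<rho> = 0)"

text \<open>For charged channels \<open>k = 0\<close> is a branch point and the poles of the Coulomb
  normalisation accumulate there along the imaginary axis. The differential equation, conjugation and
  Wronskian relations are required at every \<open>k \<noteq> 0\<close>, with no consistency of
  branches between different \<open>k\<close>; analyticity in \<open>k\<close> is required only on the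
  half-plane containing the physical wave numbers \<open>k > 0\<close>.\<close>

definition wave_functions :: "('l::finite, 'c::finite) rmatrix \<Rightarrow> 'c \<Rightarrow> bool" where
  "wave_functions d c \<longleftrightarrow>
     (\<forall>k. k \<noteq> 0 \<longrightarrow>
        radial_solution (ang_mom d c) (of_real (eta_k d c) / k) k (outgoing d c k) \<and>
        radial_solution (ang_mom d c) (of_real (eta_k d c) / k) k (incoming d c k) \<and>
        (\<forall>r>0. let \<rho> = k * of_real r in
           deriv (outgoing d c k) \<rho> * incoming d c k \<rho>
           - deriv (incoming d c k) \<rho> * outgoing d c k \<rho> = 2 * \<i>)) \<and>
     (\<forall>r>0. (\<lambda>k. outgoing d c k (k * of_real r)) holomorphic_on {k. Re k > 0} \<and>
            (\<lambda>k. deriv (outgoing d c k) (k * of_real r)) holomorphic_on {k. Re k > 0}) \<and>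
     (eta_k d c = 0 \<longrightarrow>
        (\<forall>k \<rho>. k \<noteq> 0 \<longrightarrow> \<rho> \<noteq> 0 \<longrightarrow>
           outgoing d c k \<rho> = \<i> * \<rho> * spherical_hankel1 (ang_mom d c) \<rho>))"

definition rmatrix_data :: "('l::finite, 'c::finite) rmatrix \<Rightarrow> bool" where
  "rmatrix_data d \<longleftrightarrow>
     inj (res_energy d) \<and>
     (\<forall>c. radius d c > 0 \<and> rho0 d c > 0 \<and> wave_functions d c)"

text \<open>A sheet chooses the sign of the square root in every channel.\<close>

type_synonym 'c sheet = "'c \<Rightarrow> bool"

definition rho :: "('l::finite, 'c::finite) rmatrix \<Rightarrow> 'c sheet \<Rightarrow> complex \<Rightarrow> 'c \<Rightarrow> complex" where
  "rho d s E c =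
     (if s c then 1 else - 1) * of_real (rho0 d c) * csqrt (E - of_real (threshold d c))"

definition wave_number :: "('l::finite, 'c::finite) rmatrix \<Rightarrow> 'c \<Rightarrow> complex \<Rightarrow> complex" where
  "wave_number d c \<rho> = \<rho> / of_real (radius d c)"

definition chan_O :: "('l::finite, 'c::finite) rmatrix \<Rightarrow> 'c \<Rightarrow> complex \<Rightarrow> complex" where
  "chan_O d c \<rho> = outgoing d c (wave_number d c \<rho>) \<rho>"

definition chan_I :: "('l::finite, 'c::finite) rmatrix \<Rightarrow> 'c \<Rightarrow> complex \<Rightarrow> complex" where
  "chan_I d c \<rho> = incoming d c (wave_number d c \<rho>) \<rho>"

definition chan_L :: "('l::finite, 'c::finite) rmatrix \<Rightarrow> 'c \<Rightarrow> complex \<Rightarrow> complex" where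
  "chan_L d c \<rho> = \<rho> / chan_O d c \<rho> * deriv (outgoing d c (wave_number d c \<rho>)) \<rho>"

definition width_mat :: "('l::finite, 'c::finite) rmatrix \<Rightarrow> complex^'c^'l" where
  "width_mat d = (\<chi> l c. of_real (width d $ l $ c))"

definition level_matrix_inv ::
    "('l::finite, 'c::finite) rmatrix \<Rightarrow> 'c sheet \<Rightarrow> complex \<Rightarrow> complex^'l^'l" where
  "level_matrix_inv d s E =
     diag_mat (\<lambda>l. of_real (res_energy d l)) - mat E
     - width_mat d
       ** (diag_mat (\<lambda>c. chan_L d c (rho d s E c)) - diag_mat (\<lambda>c. of_real (boundary d c)))
       ** transpose (width_mat d)"

definition level_matrix ::
    "('l::finite, 'c::finite) rmatrix \<Rightarrow> 'c sheet \<Rightarrow> complex \<Rightarrow> complex^'l^'l" where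
  "level_matrix d s E = matrix_inv (level_matrix_inv d s E)"

text \<open>\<open>scattering_of d s E G\<close> is the scattering matrix expression with \<open>G\<close> in the place
  of \<open>\<gamma>\<^sup>T A \<gamma>\<close>. For the square root of \<open>\<rho>\<close> the principal branch is taken.\<close>

definition scattering_of ::
    "('l::finite, 'c::finite) rmatrix \<Rightarrow> 'c sheet \<Rightarrow> complex \<Rightarrow> complex^'c^'c \<Rightarrow> complex^'c^'c" where
  "scattering_of d s E G =
     (let Oinv = matrix_inv (diag_mat (\<lambda>c. chan_O d c (rho d s E c)));
          Imat = diag_mat (\<lambda>c. chan_I d c (rho d s E c));
          rho_half = diag_mat (\<lambda>c. csqrt (rho d s E c))
      in Oinv ** Imat + mat (2 * \<i>) ** (rho_half ** Oinv ** G ** Oinv ** rho_half))"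

definition scattering ::
    "('l::finite, 'c::finite) rmatrix \<Rightarrow> 'c sheet \<Rightarrow> complex \<Rightarrow> complex^'c^'c" where
  "scattering d s E =
     scattering_of d s E (transpose (width_mat d) ** level_matrix d s E ** width_mat d)"

text \<open>The points of the sheeted energy surface at which all terms of the scattering matrix
  expression are defined.\<close>

definition regular_energy ::
    "('l::finite, 'c::finite) rmatrix \<Rightarrow> 'c sheet \<Rightarrow> complex \<Rightarrow> bool" where
  "regular_energy d s E \<longleftrightarrow>
     (\<forall>c. rho d s E c \<noteq> 0 \<and> chan_O d c (rho d s E c) \<noteq> 0) \<and>
     invertible (level_matrix_inv d s E)"

datatype shift_convention = Real_Part | Continuation

fun chan_S :: "shift_convention \<Rightarrow> ('l::finite, 'c::finite) rmatrix \<Rightarrow> 'c \<Rightarrow> complex \<Rightarrow> complex" where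
  "chan_S Real_Part d c \<rho> = of_real (Re (chan_L d c \<rho>))"
| "chan_S Continuation d c \<rho> = (chan_L d c \<rho> + cnj (chan_L d c (cnj \<rho>))) / 2"

fun chan_S_defined :: "shift_convention \<Rightarrow> ('l::finite, 'c::finite) rmatrix \<Rightarrow> 'c \<Rightarrow> complex \<Rightarrow> bool" where
  "chan_S_defined Real_Part d c \<rho> \<longleftrightarrow> \<rho> \<noteq> 0 \<and> chan_O d c \<rho> \<noteq> 0"
| "chan_S_defined Continuation d c \<rho> \<longleftrightarrow>
     \<rho> \<noteq> 0 \<and> chan_O d c \<rho> \<noteq> 0 \<and> chan_O d c (cnj \<rho>) \<noteq> 0"

text \<open>The normalisation is bilinear, without complex conjugation.\<close>

definition alternative_pole ::
    "shift_convention \<Rightarrow> ('l::finite, 'c::finite) rmatrix \<Rightarrow> 'c sheet \<Rightarrow> complex \<Rightarrow> complex^'l \<Rightarrow> bool" where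
  "alternative_pole conv d s E v \<longleftrightarrow>
     (\<forall>c. chan_S_defined conv d c (rho d s E c)) \<and>
     (diag_mat (\<lambda>l. of_real (res_energy d l))
      - width_mat d
        ** (diag_mat (\<lambda>c. chan_S conv d c (rho d s E c)) - diag_mat (\<lambda>c. of_real (boundary d c)))
        ** transpose (width_mat d)) *v v = E *s v \<and>
     (\<Sum>l\<in>UNIV. v $ l * v $ l) = 1"

definition pole_matrix :: "('s \<Rightarrow> complex^'l) \<Rightarrow> complex^'s^'l" where
  "pole_matrix a = (\<chi> l i. a i $ l)"

definition alt_width :: "('l::finite, 'c::finite) rmatrix \<Rightarrow> ('s \<Rightarrow> complex^'l) \<Rightarrow> complex^'c^'s" where
  "alt_width d a = transpose (pole_matrix a) ** width_mat d"

definition alt_level_matrix ::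
    "('l::finite, 'c::finite) rmatrix \<Rightarrow> ('s::finite \<Rightarrow> complex^'l) \<Rightarrow> 'c sheet \<Rightarrow> complex \<Rightarrow> complex^'s^'s" where
  "alt_level_matrix d a s E =
     pinv (transpose (pole_matrix a) ** level_matrix_inv d s E ** pole_matrix a)"

definition alt_scattering ::
    "('l::finite, 'c::finite) rmatrix \<Rightarrow> ('s::finite \<Rightarrow> complex^'l) \<Rightarrow> 'c sheet \<Rightarrow> complex \<Rightarrow> complex^'c^'c" where
  "alt_scattering d a s E =
     scattering_of d s E
       (transpose (alt_width d a) ** alt_level_matrix d a s E ** alt_width d a)"

definition reconstructs_scattering ::
    "('l::finite, 'c::finite) rmatrix \<Rightarrow> ('s::finite \<Rightarrow> complex^'l) \<Rightarrow> bool" where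
  "reconstructs_scattering d a \<longleftrightarrow>
     (\<forall>s E. regular_energy d s E \<longrightarrow> alt_scattering d a s E = scattering d s E)"

end

theory Submission
  imports Defs "HOL-Complex_Analysis.Conformal_Mappings"
begin

text \<open>If the columns of \<open>a\<close> span, then cancelling \<open>a\<close> and \<open>a\<^sup>T\<close> in \<open>M M\<^sup>+ M = M\<close> for
  \<open>M = a\<^sup>T A\<^sup>-\<^sup>1 a\<close> gives \<open>a M\<^sup>+ a\<^sup>T = A\<close>.

  Conversely, let \<open>\<gamma>\<^sup>T a M\<^sup>+ a\<^sup>T \<gamma> = \<gamma>\<^sup>T A \<gamma>\<close> at all regular energies. On the physical sheet,
  above all thresholds, the imaginary part of \<open>L\<close> is positive, so that there is an open set of regular
  energies on which \<open>A\<close> is holomorphic. There \<open>M\<close> may be singular at every energy, and then \<open>M\<^sup>+\<close> is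
  not holomorphic; but as \<open>\<gamma>\<^sup>T A \<gamma>\<close> is, a polarization argument replaces \<open>M\<^sup>+\<close> by a generalised
  inverse of fixed range and kernel. Now the dependence on \<open>L\<close> can be removed from
  both sides by the Woodbury identity. What remains is an equality of rational functions of the
  energy: the R-matrix \<open>\<gamma>\<^sup>T (e - E)\<^sup>-\<^sup>1 \<gamma>\<close>, which has a pole at every resonance energy, and
  a matrix whose common denominator is a determinant of degree at most \<open>N\<^sub>S\<close>.\<close>

section \<open>Generalised inverses of matrices\<close>

lemma matrix_add_rdistrib: "(A + B) ** C = A ** C + B ** (C :: 'a::semiring_1^'n^'m)"
  by (vector matrix_matrix_mult_def sum.distrib distrib_right)

lemma matrix_diff_ldistrib: "A ** (B - C) = A ** B - A ** (C :: 'a::ring_1^'n^'m)"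
  by (vector matrix_matrix_mult_def sum_subtractf right_diff_distrib)

lemma matrix_diff_rdistrib: "(A - B) ** C = A ** C - B ** (C :: 'a::ring_1^'n^'m)"
  by (vector matrix_matrix_mult_def sum_subtractf left_diff_distrib)

lemmas matrix_algebra = matrix_add_ldistrib matrix_add_rdistrib matrix_diff_ldistrib
  matrix_diff_rdistrib matrix_mul_assoc

lemma matrix_mult3_nth:
  "(P ** Y ** Q) $ r $ c = (\<Sum>i\<in>UNIV. \<Sum>j\<in>UNIV. P $ r $ i * Q $ j $ c * (Y $ i $ j :: 'a::comm_semiring_1))"
proof -
  have "(P ** Y ** Q) $ r $ c = (\<Sum>j\<in>UNIV. \<Sum>i\<in>UNIV. P $ r $ i * Q $ j $ c * Y $ i $ j)"
    by (simp add: matrix_matrix_mult_def sum_distrib_left sum_distrib_right mult_ac)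
  also have "\<dots> = (\<Sum>i\<in>UNIV. \<Sum>j\<in>UNIV. P $ r $ i * Q $ j $ c * Y $ i $ j)"
    by (rule sum.swap)
  finally show ?thesis .
qed

text \<open>Both \<open>p ** Z\<close> and \<open>Z ** p\<close> equal \<open>N0 ** M ** p\<close>:
  \<open>Z\<close> acts as \<open>N0 ** M\<close> on the range of \<open>p\<close> and as the
  identity on its kernel. Hence \<open>W\<close> commutes with \<open>p\<close>, and
  \<open>N1\<close> is the outer inverse of \<open>M\<close> with the range and kernel of
  \<open>N0\<close>.\<close>

lemma relative_inverse:
  fixes M :: "'a::ring_1^'n^'n"
  assumes N0: "N0 ** M0 ** N0 = N0" and p: "p = N0 ** M0"
    and Z: "Z = N0 ** M ** p + mat 1 - p" and ZW: "Z ** W = mat 1" and WZ: "W ** Z = mat 1"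
    and N1: "N1 = W ** N0"
  shows "p ** p = p" "p ** W = W ** p" "N1 ** M ** p = p" "p ** N1 = N1" "N1 ** M ** N1 = N1"
proof -
  have pN: "p ** N0 = N0" using N0 p by simp
  show pp: "p ** p = p" using pN p by (metis matrix_mul_assoc)
  have pZ: "p ** Z = N0 ** M ** p"
  proof -
    have "p ** Z = (p ** N0) ** M ** p + (p - p ** p)"
      by (simp add: Z matrix_algebra)
    then show ?thesis by (simp add: pN pp)
  qed
  have Zp: "Z ** p = N0 ** M ** p"
  proof -
    have "Z ** p = N0 ** M ** (p ** p) + (p - p ** p)"
      by (simp add: Z matrix_algebra)
    then show ?thesis by (simp add: pp)
  qed
  have "W ** p = W ** p ** (Z ** W)" by (simp add: ZW)
  also have "\<dots> = W ** (p ** Z) ** W" by (simp only: matrix_mul_assoc)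
  also have "\<dots> = W ** (Z ** p) ** W" by (simp only: pZ Zp)
  also have "\<dots> = (W ** Z) ** p ** W" by (simp only: matrix_mul_assoc)
  finally show pW: "p ** W = W ** p" by (simp add: WZ)
  show NMp: "N1 ** M ** p = p"
  proof -
    have "N1 ** M ** p = W ** (N0 ** M ** p)" by (simp add: N1 matrix_mul_assoc)
    also have "\<dots> = (W ** Z) ** p" by (simp only: Zp[symmetric] matrix_mul_assoc)
    finally show ?thesis by (simp add: WZ)
  qed
  show pN1: "p ** N1 = N1"
    by (metis N1 pW pN matrix_mul_assoc)
  show "N1 ** M ** N1 = N1"
    by (metis NMp pN1 matrix_mul_assoc)
qed

text \<open>The matrix \<open>h + g - mat 1\<close> intertwines the two idempotents: times
  \<open>h\<close> on the right, or times \<open>g\<close> on the left, it gives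
  \<open>g ** h\<close>. When \<open>g\<close> is the conjugate transpose of \<open>h\<close>, the
  product \<open>h ** W\<close> is the orthogonal projection onto the range of
  \<open>h\<close>.\<close>

lemma hermitian_projection_of_idempotent:
  fixes h :: "'a::ring_1^'n^'n"
  assumes hh: "h ** h = h" and gg: "g ** g = g" and K: "(h + g - mat 1) ** W = mat 1" "W ** (h + g - mat 1) = mat 1"
  shows "h ** W = W ** g" "h ** W ** h = h"
proof -
  let ?k = "h + g - mat 1"
  have 1: "?k ** h = g ** h" "g ** ?k = g ** h"
    by (simp_all add: matrix_algebra hh gg)
  have "W ** g = W ** g ** (?k ** W)" by (simp add: K)
  also have "\<dots> = W ** (g ** ?k) ** W" by (simp only: matrix_mul_assoc)
  also have "\<dots> = W ** (?k ** h) ** W" by (simp only: 1)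
  also have "\<dots> = (W ** ?k) ** h ** W" by (simp only: matrix_mul_assoc)
  finally show a: "h ** W = W ** g" by (simp add: K)
  have "h ** W ** h = W ** (g ** h)" by (simp only: a matrix_mul_assoc)
  also have "\<dots> = (W ** ?k) ** h" by (simp only: 1(1)[symmetric] matrix_mul_assoc)
  finally show "h ** W ** h = h" by (simp add: K)
qed


section \<open>Adjoints and the Moore-Penrose inverse\<close>

lemma matrix_inv_eq:
  assumes "A ** B = mat 1" "B ** A = mat 1"
  shows "matrix_inv A = (B :: 'a::semiring_1^'m^'n)"
proof -
  have "A ** matrix_inv A = mat 1 \<and> matrix_inv A ** A = mat 1"
    unfolding matrix_inv_def by (rule someI[of _ B]) (use assms in simp)
  then show ?thesis
    by (metis assms(2) matrix_mul_assoc matrix_mul_lid matrix_mul_rid)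
qed

lemma matrix_inv_right: "invertible A \<Longrightarrow> A ** matrix_inv A = mat 1"
  and matrix_inv_left: "invertible A \<Longrightarrow> matrix_inv A ** A = mat 1"
  by (metis invertible_def matrix_inv_eq)+

lemma transpose_diff: "transpose (A - B) = transpose A - transpose (B :: 'a::ab_group_add^'n^'m)"
  by (vector transpose_def)

lemma conj_transpose_mult: "conj_transpose (A ** B) = conj_transpose B ** conj_transpose A"
  by (vector conj_transpose_def matrix_matrix_mult_def) (simp add: mult.commute)

lemma conj_transpose_conj_transpose [simp]: "conj_transpose (conj_transpose A) = A"
  by (vector conj_transpose_def)

lemma conj_transpose_add: "conj_transpose (A + B) = conj_transpose A + conj_transpose B"
  and conj_transpose_diff: "conj_transpose (A - B) = conj_transpose A - conj_transpose B"
  and conj_transpose_mat_1 [simp]: "conj_transpose (mat 1) = mat 1"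
  by (vector conj_transpose_def mat_def)+

lemma conj_transpose_transpose: "conj_transpose (transpose A) = transpose (conj_transpose A)"
  by (vector conj_transpose_def transpose_def)

text \<open>Both \<open>A ** P\<close> and \<open>A ** Q\<close> are the orthogonal projection onto
  the range of \<open>A\<close>, and both \<open>P ** A\<close> and \<open>Q ** A\<close> are the
  orthogonal projection along its kernel.\<close>

lemma moore_penrose_unique:
  assumes "is_moore_penrose A P" "is_moore_penrose A Q"
  shows "P = Q"
proof -
  note a = assms[unfolded is_moore_penrose_def]
  have "conj_transpose (A ** P) = conj_transpose (A ** Q ** (A ** P))"
    using a by (simp add: matrix_mul_assoc)
  then have 1: "A ** P = A ** Q"
    by (metis a conj_transpose_mult matrix_mul_assoc)
  have "conj_transpose (P ** A) = conj_transpose (P ** A ** (Q ** A))"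
    using a by (metis matrix_mul_assoc)
  then have 2: "P ** A = Q ** A"
    by (metis a conj_transpose_mult matrix_mul_assoc)
  show ?thesis
    by (metis 1 2 a matrix_mul_assoc)
qed

text \<open>Over any field the linear map \<open>A\<close> has a linear section over its range; the
  matrix of that section is an inner inverse.\<close>

lemma inner_inverse_exists: "\<exists>X. A ** X ** A = (A :: 'a::field^'n^'m)"
proof -
  obtain g where g: "Vector_Spaces.linear (*s) (*s) g" "\<forall>v\<in>range ((*v) A). A *v g v = v"
    using vec.linear_exists_right_inverse_on[OF matrix_vector_mul_linear_gen vec.subspace_UNIV, of A]
    by blast
  have "A ** matrix g ** A = A"
    unfolding matrix_eq using g by (simp add: matrix_works matrix_vector_mul_assoc[symmetric])
  then show ?thesis ..
qed

lemma conj_transpose_mult_self_eq_0: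
  assumes "conj_transpose A ** A = 0"
  shows "A = 0"
proof -
  have "A $ i $ j = 0" for i j
  proof -
    have "of_real (\<Sum>k\<in>UNIV. (cmod (A $ k $ j))\<^sup>2) = (conj_transpose A ** A) $ j $ j"
      unfolding of_real_sum complex_norm_square
      by (simp add: conj_transpose_def matrix_matrix_mult_def mult.commute)
    then have "(\<Sum>k\<in>UNIV. (cmod (A $ k $ j))\<^sup>2) = 0"
      unfolding assms zero_index of_real_eq_0_iff .
    then have "(cmod (A $ i $ j))\<^sup>2 = 0"
      using sum_nonneg_eq_0_iff[of UNIV "\<lambda>k. (cmod (A $ k $ j))\<^sup>2"] by simp
    then show ?thesis by simp
  qed
  then show ?thesis by (simp add: vec_eq_iff)
qed

text \<open>By positive definiteness, \<open>A\<close> and \<open>conj_transpose A ** A\<close> have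
  the same kernel.\<close>

lemma conj_transpose_mult_cancel:
  assumes "conj_transpose A ** A ** X = conj_transpose A ** A ** Y"
  shows "A ** X = A ** Y"
proof -
  define D where "D = X - Y"
  have "conj_transpose (A ** D) ** (A ** D) = conj_transpose D ** (conj_transpose A ** A ** D)"
    by (simp add: conj_transpose_mult matrix_mul_assoc)
  also have "conj_transpose A ** A ** D = 0"
    by (simp add: D_def matrix_diff_ldistrib assms)
  finally have "A ** D = 0"
    unfolding times0_right by (rule conj_transpose_mult_self_eq_0)
  then show ?thesis by (simp add: D_def matrix_diff_ldistrib)
qed

text \<open>\<open>A\<^sup>* (A A\<^sup>*)\<^sup>- A (A\<^sup>* A)\<^sup>- A\<^sup>*\<close>, with arbitrary inner inverses, is a Moore-Penrose inverse.\<close>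

lemma moore_penrose_exists: "\<exists>P. is_moore_penrose A P"
proof -
  let ?B = "conj_transpose A"
  obtain X where X: "(?B ** A) ** X ** (?B ** A) = ?B ** A"
    using inner_inverse_exists by blast
  obtain Y where Y: "(A ** ?B) ** Y ** (A ** ?B) = A ** ?B"
    using inner_inverse_exists by blast
  have X1: "A ** X ** ?B ** A = A"
    using conj_transpose_mult_cancel[of A "X ** ?B ** A" "mat 1"] X by (simp add: matrix_mul_assoc)
  have Y1: "?B ** Y ** A ** ?B = ?B"
    using conj_transpose_mult_cancel[of ?B "Y ** A ** ?B" "mat 1"] Y by (simp add: matrix_mul_assoc)
  have X2: "?B ** A ** conj_transpose X ** ?B = ?B"
    using arg_cong[OF X1, of conj_transpose] by (simp add: conj_transpose_mult matrix_mul_assoc)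
  have Y2: "A ** ?B ** conj_transpose Y ** A = A"
    using arg_cong[OF Y1, of conj_transpose] by (simp add: conj_transpose_mult matrix_mul_assoc)
  define P where "P = ?B ** Y ** A ** X ** ?B"
  have AY: "A ** ?B ** Y ** A = A"
    using conj_transpose_mult_cancel[of ?B "Y ** A ** ?B" "mat 1"] Y1 Y2
    by (metis conj_transpose_mult conj_transpose_conj_transpose matrix_mul_assoc)
  \<comment> \<open>Only \<open>X\<close> remains in \<open>A ** P\<close> and only \<open>Y\<close>
    in \<open>P ** A\<close>, so each of the two Hermitian conditions concerns a single inner
    inverse.\<close>
  have AP: "A ** P = A ** X ** ?B"
    unfolding P_def by (metis AY matrix_mul_assoc)
  have XB: "?B ** A ** X ** ?B = ?B"
    by (metis X1 X2 conj_transpose_mult conj_transpose_conj_transpose matrix_mul_assoc)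
  have PA: "P ** A = ?B ** Y ** A"
    unfolding P_def by (metis X1 matrix_mul_assoc)
  have "conj_transpose (A ** P) = A ** P"
  proof -
    have "conj_transpose (A ** X ** ?B) = A ** conj_transpose X ** ?B"
      by (simp add: conj_transpose_mult matrix_mul_assoc)
    also have "\<dots> = A ** X ** (?B ** A ** conj_transpose X ** ?B)"
      by (metis X1 matrix_mul_assoc)
    finally show ?thesis by (simp add: AP X2)
  qed
  moreover have "conj_transpose (P ** A) = P ** A"
  proof -
    have "conj_transpose (?B ** Y ** A) = ?B ** conj_transpose Y ** A"
      by (simp add: conj_transpose_mult matrix_mul_assoc)
    also have "\<dots> = ?B ** Y ** (A ** ?B ** conj_transpose Y ** A)"
      by (metis Y1 matrix_mul_assoc)
    finally show ?thesis by (simp add: PA Y2)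
  qed
  moreover have "A ** P ** A = A" by (simp add: AP X1)
  moreover have "P ** A ** P = P"
  proof -
    have "P ** A ** P = ?B ** Y ** (A ** P)" by (simp add: PA matrix_mul_assoc)
    also have "\<dots> = P" unfolding AP by (simp add: P_def matrix_mul_assoc)
    finally show ?thesis .
  qed
  ultimately have "is_moore_penrose A P" by (simp add: is_moore_penrose_def)
  then show ?thesis ..
qed

lemma is_moore_penrose_pinv: "is_moore_penrose A (pinv A)"
  unfolding pinv_def
  by (rule theI', rule ex_ex1I[OF moore_penrose_exists moore_penrose_unique])

lemma pinv_eq: "is_moore_penrose A P \<Longrightarrow> pinv A = P"
  by (rule moore_penrose_unique[OF is_moore_penrose_pinv])

text \<open>The Penrose equations are stable under transposition, the two projections changing
  places. In particular a symmetric matrix has a symmetric pseudo-inverse.\<close>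

lemma transpose_pinv: "transpose (pinv A) = pinv (transpose A)"
proof (rule pinv_eq[symmetric])
  note a = is_moore_penrose_pinv[of A, unfolded is_moore_penrose_def]
  have "transpose A ** transpose (pinv A) ** transpose A = transpose (A ** pinv A ** A)"
    "transpose (pinv A) ** transpose A ** transpose (pinv A) = transpose (pinv A ** A ** pinv A)"
    by (simp_all only: matrix_transpose_mul matrix_mul_assoc)
  moreover have "conj_transpose (transpose A ** transpose (pinv A)) = transpose A ** transpose (pinv A)"
    "conj_transpose (transpose (pinv A) ** transpose A) = transpose (pinv A) ** transpose A"
    using a by (simp_all only: conj_transpose_transpose flip: matrix_transpose_mul)
  ultimately show "is_moore_penrose (transpose A) (transpose (pinv A))"
    using a by (simp only: is_moore_penrose_def)
qed

text \<open>The idempotent \<open>h = 1 - N1 M\<close> kills the range of \<open>p\<close>, so its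
  rank is at most that of \<open>1 - p\<close>, hence at most the kernel dimension of
  \<open>M0\<close> and so of \<open>M\<close>. As its range contains the kernel of
  \<open>M\<close>, the two agree and \<open>M ** h = 0\<close>.\<close>

lemma inner_inverse_of_kernel_dim_le:
  fixes M M0 :: "'a::field^'n^'n"
  assumes MNM0: "M0 ** N0 ** M0 = M0" and p: "p = N0 ** M0" and N1p: "N1 ** M ** p = p"
    and N1: "N1 ** M ** N1 = N1"
    and dim: "vec.dim {x. M0 *v x = 0} \<le> vec.dim {x. M *v x = 0}"
  shows "M ** N1 ** M = M"
proof -
  define h where "h = mat 1 - N1 ** M"
  have hh0: "h ** (mat 1 - p) = h"
    by (simp add: h_def matrix_algebra N1p)
  have sub0: "range ((*v) (mat 1 - p)) \<subseteq> {x. M0 *v x = 0}"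
    by (auto simp: matrix_vector_mul_assoc matrix_algebra p MNM0)
  have "range ((*v) h) = (*v) h ` range ((*v) (mat 1 - p))"
    by (simp add: image_image matrix_vector_mul_assoc hh0)
  then have "vec.dim (range ((*v) h)) \<le> vec.dim (range ((*v) (mat 1 - p)))"
    by (simp add: vec.dim_image_le matrix_vector_mul_linear_gen)
  also have "\<dots> \<le> vec.dim {x. M0 *v x = 0}"
    by (rule vec.dim_subset[OF sub0])
  also note dim
  finally have d: "vec.dim (range ((*v) h)) \<le> vec.dim {x. M *v x = 0}" .
  have "{x. M *v x = 0} \<subseteq> range ((*v) h)"
  proof
    fix x assume "x \<in> {x. M *v x = 0}"
    then have "h *v x = x"
      by (simp add: h_def matrix_vector_mult_diff_rdistrib flip: matrix_vector_mul_assoc)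
    then show "x \<in> range ((*v) h)" by (metis rangeI)
  qed
  moreover have "vec.subspace {x. M *v x = 0}"
    by (auto simp: vec.subspace_def vec.add vec.scale)
  moreover have "vec.subspace (range ((*v) h))"
    using vec.subspace_UNIV by (intro vec.subspace_image)
  ultimately have "{x. M *v x = 0} = range ((*v) h)"
    using vec.subspace_dim_equal d by blast
  then have "M *v (h *v x) = 0" for x by blast
  then have "M ** h = 0"
    by (simp add: matrix_eq flip: matrix_vector_mul_assoc)
  then show ?thesis by (simp add: h_def matrix_algebra)
qed

text \<open>Since \<open>N1 = N1 ** transpose p\<close> and \<open>N1\<close> inverts
  \<open>M\<close> on the range of \<open>p\<close>, it follows that
  \<open>N1 = N1 ** M ** transpose N1\<close>, which is visibly symmetric.\<close>

lemma symmetric_relative_inverse: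
  fixes M N0 :: "'a::comm_ring_1^'n^'n"
  assumes "transpose M = M" "transpose N0 = N0" "p ** N0 = N0" and N1: "N1 = W ** N0"
    and N1p: "N1 ** M ** p = p"
  shows "transpose N1 = N1"
proof -
  have "N0 ** transpose p = N0"
    using assms by (metis matrix_transpose_mul)
  then have "N1 = N1 ** transpose p"
    by (metis N1 matrix_mul_assoc)
  also have "transpose p = transpose p ** M ** transpose N1"
    by (metis N1p assms(1) matrix_transpose_mul matrix_mul_assoc)
  also have "N1 ** (transpose p ** M ** transpose N1) = N1 ** M ** transpose N1"
    by (metis \<open>N1 = N1 ** transpose p\<close> matrix_mul_assoc)
  finally have 1: "N1 = N1 ** M ** transpose N1" .
  then have "transpose N1 = N1 ** M ** transpose N1"
    by (metis assms(1) matrix_transpose_mul matrix_mul_assoc transpose_transpose)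
  with 1 show ?thesis by simp
qed

text \<open>The range of \<open>h\<close> is the kernel of \<open>M\<close>, so \<open>Q\<close> is
  the orthogonal projection onto that kernel. Cutting \<open>N\<close> down by the complementary
  projections turns the two oblique projections into \<open>1 - Q\<close> and its transpose, which
  are Hermitian. Conjugation enters the formula only through \<open>Q\<close>.\<close>

lemma pinv_of_symmetric_inverse:
  fixes M N :: "complex^'n^'n"
  assumes sym: "transpose M = M" "transpose N = N"
    and MNM: "M ** N ** M = M" and NMN: "N ** M ** N = N"
    and h: "h = mat 1 - N ** M" and inv: "invertible (h + conj_transpose h - mat 1)"
    and Pi: "Q = h ** matrix_inv (h + conj_transpose h - mat 1)"
  shows "pinv M = (mat 1 - Q) ** N ** (mat 1 - transpose Q)"
proof (rule pinv_eq)
  define k where "k = h + conj_transpose h - mat 1"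
  define W where "W = matrix_inv k"
  have kW: "k ** W = mat 1" "W ** k = mat 1"
    using inv by (simp_all add: W_def k_def matrix_inv_left matrix_inv_right)
  have hh: "h ** h = h" by (simp add: h matrix_algebra NMN)
  then have gg: "conj_transpose h ** conj_transpose h = conj_transpose h"
    by (metis conj_transpose_mult)
  note Q = hermitian_projection_of_idempotent[OF hh gg kW[unfolded k_def]]
  have Q_def: "Q = h ** W" using Pi by (simp add: W_def k_def)
  have "conj_transpose k = k"
    by (simp add: k_def conj_transpose_add conj_transpose_diff add.commute)
  then have "conj_transpose W = W"
    by (metis conj_transpose_mat_1 conj_transpose_mult kW matrix_mul_assoc matrix_mul_lid matrix_mul_rid)
  then have Qh: "conj_transpose Q = Q"
    by (simp add: Q_def conj_transpose_mult Q(1))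
  have Qh': "Q ** h = h" and QQ: "Q ** Q = Q"
    using Q(2) by (simp_all add: Q_def matrix_mul_assoc)
  have Mh: "M ** h = 0" by (simp add: h matrix_algebra MNM)
  then have MQ: "M ** Q = 0" by (simp add: Q_def matrix_mul_assoc)
  define P where "P = (mat 1 - Q) ** N ** (mat 1 - transpose Q)"
  have "(mat 1 - Q) ** (mat 1 - h) = mat 1 - Q"
    by (simp add: matrix_algebra Qh')
  then have "transpose (mat 1 - h) ** transpose (mat 1 - Q) = transpose (mat 1 - Q)"
    by (metis matrix_transpose_mul)
  moreover have "transpose (mat 1 - h) = M ** N"
    by (simp add: h matrix_transpose_mul sym)
  ultimately have MN: "M ** N ** (mat 1 - transpose Q) = mat 1 - transpose Q"
    by (simp add: transpose_diff)
  have "M ** (mat 1 - Q) = M" by (simp add: matrix_algebra MQ)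
  then have MP: "M ** P = mat 1 - transpose Q"
    by (simp add: P_def matrix_mul_assoc MN)
  have "transpose P = P"
    by (simp add: P_def matrix_transpose_mul transpose_diff sym matrix_mul_assoc)
  then have PM: "P ** M = mat 1 - Q"
    using arg_cong[OF MP, of transpose] by (simp add: matrix_transpose_mul transpose_diff sym)
  have "(mat 1 - Q) ** (mat 1 - Q) = mat 1 - Q"
    by (simp add: matrix_algebra QQ)
  then have "P ** M ** P = P"
    by (simp add: PM) (simp add: P_def matrix_mul_assoc)
  moreover have "M ** P ** M = M"
    using \<open>M ** (mat 1 - Q) = M\<close> by (metis PM matrix_mul_assoc)
  moreover have "conj_transpose (M ** P) = M ** P" "conj_transpose (P ** M) = P ** M"
    by (simp_all add: MP PM conj_transpose_diff conj_transpose_transpose Qh)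
  ultimately show "is_moore_penrose M ((mat 1 - Q) ** N ** (mat 1 - transpose Q))"
    by (simp add: is_moore_penrose_def flip: P_def)
qed

section \<open>Holomorphic matrix functions\<close>

lemma islimpt_ball_Reals: "0 < r \<Longrightarrow> (0::complex) islimpt (ball 0 r \<inter> \<real>)"
  unfolding islimpt_approachable
proof (intro allI impI)
  fix e :: real assume "0 < r" "0 < e"
  then show "\<exists>x'\<in>ball 0 r \<inter> \<real>. x' \<noteq> (0::complex) \<and> dist x' 0 < e"
    by (intro bexI[of _ "of_real (min r e / 2)"]) (auto simp: min_def)
qed

lemma holomorphic_vanish_on_Reals:
  assumes "f holomorphic_on ball 0 r" "\<And>x. x \<in> ball 0 r \<inter> \<real> \<Longrightarrow> f x = 0" "z \<in> ball 0 r"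
  shows "f z = (0::complex)"
proof -
  have "0 < r" using assms(3) by (metis mem_ball dist_norm le_less_trans zero_le_dist)
  then show ?thesis
    using analytic_continuation[OF assms(1) _ _ _ _ islimpt_ball_Reals, of r] assms by auto
qed

text \<open>A function of \<open>z\<close> and \<open>cnj z\<close> that is holomorphic in both and vanishes on the
  diagonal vanishes for independent arguments: in the coordinates \<open>u + \<i> v\<close>, \<open>u - \<i> v\<close> the
  diagonal consists of the real points.\<close>

lemma polarized_identity:
  fixes \<phi> :: "complex \<Rightarrow> complex \<Rightarrow> complex"
  assumes hol: "\<And>f g S. \<lbrakk>open S; f holomorphic_on S; g holomorphic_on S;
      f ` S \<subseteq> ball z0 r; g ` S \<subseteq> ball (cnj z0) r\<rbrakk> \<Longrightarrow> (\<lambda>x. \<phi> (f x) (g x)) holomorphic_on S"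
    and diag: "\<And>z. z \<in> ball z0 r \<Longrightarrow> \<phi> z (cnj z) = 0"
    and z: "z \<in> ball z0 r"
  shows "\<phi> z (cnj z0) = 0"
proof -
  define B where "B = ball (0::complex) (r / 2)"
  let ?f = "\<lambda>u v. z0 + u + \<i> * v" and ?g = "\<lambda>u v. cnj z0 + u - \<i> * v"
  have bound: "norm (u + \<i> * v) < r" "norm (u - \<i> * v) < r" if "u \<in> B" "v \<in> B" for u v
    using that norm_triangle_ineq[of u "\<i> * v"] norm_triangle_ineq4[of u "\<i> * v"]
    by (auto simp: B_def norm_mult)
  have mem: "?f u v \<in> ball z0 r" "?g u v \<in> ball (cnj z0) r" if "u \<in> B" "v \<in> B" for u v
    using bound[OF that] by (simp_all add: dist_norm norm_minus_commute algebra_simps)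
      (metis add.commute norm_minus_cancel minus_diff_eq diff_minus_eq_add minus_add_distrib add_uminus_conv_diff)+
  \<comment> \<open>The one-variable identity theorem is used twice: first \<open>u\<close> becomes
    complex while \<open>v\<close> stays real, then \<open>v\<close> becomes complex as
    well.\<close>
  have 1: "\<phi> (?f u v) (?g u v) = 0" if "u \<in> B" "v \<in> B" "v \<in> \<real>" for u v
  proof -
    have "(\<lambda>u. \<phi> (?f u v) (?g u v)) holomorphic_on B"
      using mem that by (intro hol) (auto simp: B_def intro!: holomorphic_intros)
    moreover have "\<phi> (?f x v) (?g x v) = 0" if "x \<in> B \<inter> \<real>" for x
    proof -
      have "cnj (?f x v) = ?g x v"
        using that \<open>v \<in> \<real>\<close> by (auto elim!: Reals_cases)
      moreover have "\<phi> (?f x v) (cnj (?f x v)) = 0"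
        using mem(1) that \<open>v \<in> B\<close> by (intro diag) auto
      ultimately show ?thesis by (simp only:)
    qed
    ultimately show ?thesis
      using holomorphic_vanish_on_Reals[of "\<lambda>u. \<phi> (?f u v) (?g u v)" "r / 2" u] that(1)
      unfolding B_def by blast
  qed
  have 2: "\<phi> (?f u v) (?g u v) = 0" if "u \<in> B" "v \<in> B" for u v
  proof -
    have "(\<lambda>v. \<phi> (?f u v) (?g u v)) holomorphic_on B"
      using mem that by (intro hol) (auto simp: B_def intro!: holomorphic_intros)
    moreover have "\<phi> (?f u x) (?g u x) = 0" if "x \<in> B \<inter> \<real>" for x
      using 1[of u x] that \<open>u \<in> B\<close> by blast
    ultimately show ?thesis
      using holomorphic_vanish_on_Reals[of "\<lambda>v. \<phi> (?f u v) (?g u v)" "r / 2" v] that(2)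
      unfolding B_def by blast
  qed
  \<comment> \<open>With \<open>v = - \<i> * u\<close> the second argument collapses to
    \<open>cnj z0\<close>, while the first is \<open>z0 + 2 * u\<close>.\<close>
  define u where "u = (z - z0) / 2"
  have "norm u < r / 2"
    using z by (simp add: u_def norm_divide dist_norm norm_minus_commute)
  then have "\<phi> (?f u (- \<i> * u)) (?g u (- \<i> * u)) = 0"
    by (intro 2) (auto simp: B_def norm_mult)
  moreover have "?f u (- \<i> * u) = z" "?g u (- \<i> * u) = cnj z0"
    by (simp_all add: u_def flip: mult.assoc) (simp_all add: field_simps)
  ultimately show ?thesis by simp
qed

section \<open>Calculus of holomorphic matrix functions\<close>

definition matrix_holomorphic_on :: "(complex \<Rightarrow> complex^'n^'m) \<Rightarrow> complex set \<Rightarrow> bool" where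
  "matrix_holomorphic_on F S \<longleftrightarrow> (\<forall>i j. (\<lambda>z. F z $ i $ j) holomorphic_on S)"

lemma matrix_holomorphic_on_subset:
  "matrix_holomorphic_on F S \<Longrightarrow> T \<subseteq> S \<Longrightarrow> matrix_holomorphic_on F T"
  unfolding matrix_holomorphic_on_def by (blast intro: holomorphic_on_subset)

lemma matrix_holomorphic_compose:
  assumes "matrix_holomorphic_on F T" "f holomorphic_on S" "f ` S \<subseteq> T"
  shows "matrix_holomorphic_on (\<lambda>z. F (f z)) S"
  unfolding matrix_holomorphic_on_def
proof (intro allI)
  fix i j
  have "(\<lambda>z. F z $ i $ j) holomorphic_on T"
    using assms(1) by (simp add: matrix_holomorphic_on_def)
  from holomorphic_on_compose_gen[OF assms(2) this assms(3)]
  show "(\<lambda>z. F (f z) $ i $ j) holomorphic_on S" by (simp add: o_def)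
qed

lemma matrix_holomorphic_const: "matrix_holomorphic_on (\<lambda>z. A) S"
  and matrix_holomorphic_add: "matrix_holomorphic_on F S \<Longrightarrow> matrix_holomorphic_on G S \<Longrightarrow>
    matrix_holomorphic_on (\<lambda>z. F z + G z) S"
  and matrix_holomorphic_diff: "matrix_holomorphic_on F S \<Longrightarrow> matrix_holomorphic_on G S \<Longrightarrow>
    matrix_holomorphic_on (\<lambda>z. F z - G z) S"
  and matrix_holomorphic_transpose: "matrix_holomorphic_on F S \<Longrightarrow>
    matrix_holomorphic_on (\<lambda>z. transpose (F z)) S"
  by (simp_all add: matrix_holomorphic_on_def transpose_def holomorphic_intros)

lemma matrix_holomorphic_mult: "matrix_holomorphic_on F S \<Longrightarrow> matrix_holomorphic_on G S \<Longrightarrow>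
    matrix_holomorphic_on (\<lambda>z. F z ** G z) S"
  by (auto simp: matrix_holomorphic_on_def matrix_matrix_mult_def intro!: holomorphic_intros)

lemma holomorphic_det: "matrix_holomorphic_on F S \<Longrightarrow> (\<lambda>z. det (F z)) holomorphic_on S"
  by (auto simp: matrix_holomorphic_on_def det_def intro!: holomorphic_intros)

text \<open>Cramer's rule for column \<open>j\<close> of the inverse. It serves both for the
  holomorphy of inverses and for writing the inverse of a matrix pencil as a quotient of
  polynomials.\<close>

lemma matrix_inv_nth:
  fixes A :: "'a::field^'n^'n"
  assumes "invertible A"
  shows "matrix_inv A $ i $ j = det (\<chi> r c. if c = i then mat 1 $ r $ j else A $ r $ c) / det A"
proof -
  have "A *v (matrix_inv A *v axis j 1) = axis j 1"
    by (simp add: matrix_vector_mul_assoc matrix_inv_right assms)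
  then have "matrix_inv A *v axis j 1 =
      (\<chi> k. det (\<chi> r c. if c = k then axis j 1 $ r else A $ r $ c) / det A)"
    using assms by (simp add: cramer invertible_det_nz)
  then have "(matrix_inv A *v axis j 1) $ i =
      det (\<chi> r c. if c = i then axis j 1 $ r else A $ r $ c) / det A"
    by simp
  moreover have "(matrix_inv A *v axis j 1) $ i = matrix_inv A $ i $ j"
    by (simp add: matrix_vector_mult_def axis_def if_distrib cong: if_cong)
  moreover have "axis j 1 $ r = (mat 1 :: 'a^'n^'n) $ r $ j" for r
    by (simp add: axis_def mat_def)
  ultimately show ?thesis by (simp only:)
qed

lemma matrix_holomorphic_inv:
  fixes F :: "complex \<Rightarrow> complex^'n^'n"
  assumes "matrix_holomorphic_on F S" "\<And>z. z \<in> S \<Longrightarrow> invertible (F z)"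
  shows "matrix_holomorphic_on (\<lambda>z. matrix_inv (F z)) S"
  unfolding matrix_holomorphic_on_def
proof (intro allI)
  fix i j
  have "matrix_holomorphic_on (\<lambda>z. \<chi> r c. if c = i then mat 1 $ r $ j else F z $ r $ c) S"
    unfolding matrix_holomorphic_on_def
  proof (intro allI)
    fix r c
    show "(\<lambda>z. (\<chi> r c. if c = i then mat 1 $ r $ j else F z $ r $ c) $ r $ c) holomorphic_on S"
      using assms(1) by (cases "c = i") (simp_all add: matrix_holomorphic_on_def)
  qed
  then have "(\<lambda>z. det (\<chi> r c. if c = i then mat 1 $ r $ j else F z $ r $ c) / det (F z))
      holomorphic_on S"
    using assms by (intro holomorphic_on_divide holomorphic_det) (auto simp: invertible_det_nz)
  then show "(\<lambda>z. matrix_inv (F z) $ i $ j) holomorphic_on S"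
    using holomorphic_transform[of _ S "\<lambda>z. matrix_inv (F z) $ i $ j"] assms(2)
    by (simp add: matrix_inv_nth)
qed

text \<open>The two conjugations cancel. Polarization needs this form, in which the conjugate of the
  energy has become an independent variable.\<close>

lemma matrix_holomorphic_conj_transpose_cnj:
  assumes "matrix_holomorphic_on F (cnj ` S)" "open S"
  shows "matrix_holomorphic_on (\<lambda>z. conj_transpose (F (cnj z))) S"
  unfolding matrix_holomorphic_on_def
proof (intro allI)
  fix i j
  have "(\<lambda>z. F z $ j $ i) holomorphic_on cnj ` S"
    using assms(1) by (simp add: matrix_holomorphic_on_def)
  from holomorphic_on_compose_cnj_cnj[OF this assms(2)]
  show "(\<lambda>z. conj_transpose (F (cnj z)) $ i $ j) holomorphic_on S"
    by (simp add: conj_transpose_def o_def)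
qed

lemmas matrix_holomorphic_intros = matrix_holomorphic_const matrix_holomorphic_add
  matrix_holomorphic_diff matrix_holomorphic_transpose matrix_holomorphic_mult

text \<open>The determinant is continuous. The domain is general because the lemma is applied to one
  complex variable and to pairs of them.\<close>

lemma eventually_nhds_invertible:
  fixes F :: "'a::t2_space \<Rightarrow> complex^'n^'n"
  assumes "\<And>i j. isCont (\<lambda>z. F z $ i $ j) a" "invertible (F a)"
  shows "eventually (\<lambda>z. invertible (F z)) (nhds a)"
proof -
  have "isCont (\<lambda>z. det (F z)) a"
    unfolding det_def by (intro continuous_intros assms)
  then have "((\<lambda>z. det (F z)) \<longlongrightarrow> det (F a)) (nhds a)"
    using tendsto_at_iff_tendsto_nhds[of "\<lambda>z. det (F z)" a] by (simp add: continuous_at)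
  then show ?thesis
    using tendsto_imp_eventually_ne[of _ "det (F a)" "nhds a" 0] assms(2)
    by (simp add: invertible_det_nz)
qed

lemma matrix_holomorphic_isCont:
  assumes "matrix_holomorphic_on F S" "open S" "a \<in> S"
  shows "isCont (\<lambda>z. F z $ i $ j) a"
proof -
  have "continuous_on S (\<lambda>z. F z $ i $ j)"
    using assms(1) by (simp add: matrix_holomorphic_on_def holomorphic_on_imp_continuous_on)
  then show ?thesis
    using assms(2,3) by (simp add: continuous_on_eq_continuous_at)
qed

lemma matrix_holomorphic_invertible_ball:
  fixes F :: "complex \<Rightarrow> complex^'n^'n"
  assumes "matrix_holomorphic_on F S" "open S" "a \<in> S" "invertible (F a)"
  obtains r where "r > 0" "ball a r \<subseteq> S" "\<And>z. z \<in> ball a r \<Longrightarrow> invertible (F z)"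
proof -
  have "eventually (\<lambda>z. invertible (F z) \<and> z \<in> S) (nhds a)"
    using eventually_nhds_invertible[OF matrix_holomorphic_isCont[OF assms(1-3)] assms(4)] assms(2,3)
    by (simp add: eventually_conj eventually_nhds_in_open)
  then obtain r where "r > 0" "\<And>z. dist z a < r \<Longrightarrow> invertible (F z) \<and> z \<in> S"
    by (auto simp: eventually_nhds_metric)
  moreover from this have "ball a r \<subseteq> S" by (auto simp: dist_commute)
  ultimately show ?thesis by (intro that[of r]) (auto simp: dist_commute)
qed

text \<open>Polarization decouples an energy from its conjugate, so invertibility is needed for all
  pairs near \<open>(a, a)\<close> and not only on the diagonal.\<close>

lemma invertible_of_invertible_at_diagonal:
  assumes h: "matrix_holomorphic_on h S" "open S" "a \<in> S"
    and inv: "invertible (h a + conj_transpose (h a) - mat 1)"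
  obtains r where "r > 0"
    "\<And>z w. z \<in> ball a r \<Longrightarrow> w \<in> ball a r \<Longrightarrow> invertible (h z + conj_transpose (h w) - mat 1)"
proof -
  have "\<forall>\<^sub>F x in nhds (a, a). invertible (h (fst x) + conj_transpose (h (snd x)) - mat 1)"
  proof (rule eventually_nhds_invertible)
    fix i j
    have "isCont (\<lambda>x. h (fst x) $ i $ j) (a, a)"
      by (rule isCont_o2[where f = fst and g = "\<lambda>z. h z $ i $ j"])
        (simp_all add: matrix_holomorphic_isCont[OF h] continuous_intros)
    moreover have "isCont (\<lambda>x. h (snd x) $ j $ i) (a, a)"
      by (rule isCont_o2[where f = snd and g = "\<lambda>z. h z $ j $ i"])
        (simp_all add: matrix_holomorphic_isCont[OF h] continuous_intros)
    ultimately have "isCont (\<lambda>x. h (fst x) $ i $ j + cnj (h (snd x) $ j $ i) - mat 1 $ i $ j) (a, a)"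
      by (intro isCont_add isCont_diff isCont_cnj continuous_const)
    then show "isCont (\<lambda>x. (h (fst x) + conj_transpose (h (snd x)) - mat 1) $ i $ j) (a, a)"
      by (simp add: conj_transpose_def)
  qed (simp add: inv)
  then have "\<forall>\<^sub>F x in nhds a \<times>\<^sub>F nhds a. invertible (h (fst x) + conj_transpose (h (snd x)) - mat 1)"
    by (simp add: nhds_prod)
  then obtain P Q where P: "eventually P (nhds a)" "eventually Q (nhds a)"
    "\<And>z w. P z \<Longrightarrow> Q w \<Longrightarrow> invertible (h z + conj_transpose (h w) - mat 1)"
    by (auto simp: eventually_prod_filter)
  have "eventually (\<lambda>z. P z \<and> Q z) (nhds a)"
    using P by (simp add: eventually_conj)
  then obtain r where "r > 0" "\<And>z. dist z a < r \<Longrightarrow> P z \<and> Q z"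
    by (auto simp: eventually_nhds_metric)
  then show ?thesis using that[of r] P(3) by (auto simp: dist_commute)
qed

text \<open>The point \<open>a\<close> is one of maximal rank and \<open>M0 = M a\<close>, \<open>N0 = pinv M0\<close>. Near \<open>a\<close>, the matrix
  \<open>matrix_inv (N0 M p + 1 - p) N0\<close> with \<open>p = N0 M0\<close> is the inner inverse of \<open>M\<close> with the range
  and kernel of \<open>N0\<close>. It differs from the pseudo-inverse by the orthogonal projection onto the kernel of
  \<open>M\<close>, which is a function of \<open>h\<close> and its conjugate transpose for an oblique projection \<open>h\<close>
  that is holomorphic; by polarization the conjugate may be frozen at \<open>a\<close>, where it disappears.\<close>

lemma holomorphic_compression_of_pinv:
  fixes M :: "complex \<Rightarrow> complex^'s^'s" and q :: "complex^'c^'s"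
  assumes S: "open S" "S \<noteq> {}" and M: "matrix_holomorphic_on M S"
    and sym: "\<And>z. transpose (M z) = M z"
    and G: "matrix_holomorphic_on G S"
    and eq: "\<And>z. z \<in> S \<Longrightarrow> transpose q ** pinv (M z) ** q = G z"
  obtains N0 M0 a r where "r > 0" "ball a r \<subseteq> S" "N0 ** M0 ** N0 = N0"
    "\<And>z. z \<in> ball a r \<Longrightarrow> invertible (N0 ** M z ** (N0 ** M0) + mat 1 - N0 ** M0)"
    "\<And>z. z \<in> ball a r \<Longrightarrow>
       transpose q ** (matrix_inv (N0 ** M z ** (N0 ** M0) + mat 1 - N0 ** M0) ** N0) ** q = G z"
proof -
  obtain a where a: "a \<in> S" and min: "\<And>z. z \<in> S \<Longrightarrow> vec.dim {x. M a *v x = 0} \<le> vec.dim {x. M z *v x = 0}"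
    using S(2) arg_min_nat_lemma[of "\<lambda>z. z \<in> S" _ "\<lambda>z. vec.dim {x. M z *v x = 0}"] by blast
  define M0 where "M0 = M a"
  define N0 where "N0 = pinv M0"
  define p where "p = N0 ** M0"
  define Z where "Z = (\<lambda>z. N0 ** M z ** p + mat 1 - p)"
  define N1 where "N1 = (\<lambda>z. matrix_inv (Z z) ** N0)"
  define h where "h = (\<lambda>z. mat 1 - N1 z ** M z)"
  have mp: "M0 ** N0 ** M0 = M0" "N0 ** M0 ** N0 = N0" "conj_transpose p = p"
    using is_moore_penrose_pinv[of M0] by (simp_all add: N0_def is_moore_penrose_def p_def)
  have N0_sym: "transpose N0 = N0"
    by (simp add: N0_def M0_def transpose_pinv sym)
  have pN0: "p ** N0 = N0" by (simp add: p_def mp)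
  have pp: "p ** p = p" by (metis p_def pN0 matrix_mul_assoc)
  have Zhol: "matrix_holomorphic_on Z S"
    unfolding Z_def by (intro matrix_holomorphic_intros M)
  have Za: "Z a = mat 1"
    by (simp add: Z_def pp flip: M0_def p_def)
  then have "invertible (Z a)" by (simp add: invertible_def)
  then obtain r1 where r1: "r1 > 0" "ball a r1 \<subseteq> S" "\<And>z. z \<in> ball a r1 \<Longrightarrow> invertible (Z z)"
    using matrix_holomorphic_invertible_ball[OF Zhol S(1) a] by metis
  have N1hol: "matrix_holomorphic_on N1 (ball a r1)"
    unfolding N1_def
    by (intro matrix_holomorphic_intros matrix_holomorphic_inv matrix_holomorphic_on_subset[OF Zhol])
      (use r1 in auto)
  have hhol: "matrix_holomorphic_on h (ball a r1)"
    unfolding h_def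
    by (intro matrix_holomorphic_intros N1hol matrix_holomorphic_on_subset[OF M]) (use r1 in auto)
  have rel: "N1 z ** M z ** p = p" "p ** N1 z = N1 z" "N1 z ** M z ** N1 z = N1 z"
    if "z \<in> ball a r1" for z
  proof -
    have Z: "Z z = N0 ** M z ** p + mat 1 - p" and N1: "N1 z = matrix_inv (Z z) ** N0"
      by (simp_all add: Z_def N1_def)
    note inv = r1(3)[OF that]
    show "N1 z ** M z ** p = p" "p ** N1 z = N1 z" "N1 z ** M z ** N1 z = N1 z"
      by (rule relative_inverse(3-5)[OF mp(2) p_def Z matrix_inv_right[OF inv] matrix_inv_left[OF inv] N1])+
  qed
  have MNM: "M z ** N1 z ** M z = M z" if "z \<in> ball a r1" for z
    using inner_inverse_of_kernel_dim_le[OF mp(1) p_def rel(1,3)[OF that]] min[of z] that r1(2)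
    by (auto simp: M0_def)
  have N1_sym: "transpose (N1 z) = N1 z" if "z \<in> ball a r1" for z
    by (rule symmetric_relative_inverse[OF sym N0_sym pN0 _ rel(1)[OF that]]) (simp add: N1_def)
  have "N1 a = N0" by (simp add: N1_def Za matrix_inv_eq)
  then have ha: "h a = mat 1 - p" by (simp add: h_def p_def M0_def)
  \<comment> \<open>At \<open>a\<close> the projection \<open>h\<close> is Hermitian, and
    \<open>h + conj_transpose h - mat 1\<close> becomes the reflection \<open>p' - p\<close>, its
    own inverse.\<close>
  define p' where "p' = mat 1 - p"
  have "p' ** p' = p'" "p' ** p = 0" "p ** p' = 0"
    by (simp_all add: p'_def matrix_algebra pp)
  then have "(p' - p) ** (p' - p) = p' + p"
    by (simp add: matrix_diff_ldistrib matrix_diff_rdistrib pp)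
  moreover have "h a + conj_transpose (h a) - mat 1 = p' - p" "p' + p = mat 1"
    by (simp_all add: ha conj_transpose_diff mp(3) p'_def)
  ultimately have "(h a + conj_transpose (h a) - mat 1) ** (h a + conj_transpose (h a) - mat 1) = mat 1"
    by simp
  then have inva: "invertible (h a + conj_transpose (h a) - mat 1)"
    unfolding invertible_def by blast
  then obtain r2 where r2: "r2 > 0" "\<And>z w. z \<in> ball a r2 \<Longrightarrow> w \<in> ball a r2 \<Longrightarrow>
      invertible (h z + conj_transpose (h w) - mat 1)"
    using invertible_of_invertible_at_diagonal[OF hhol] r1(1) by (metis centre_in_ball open_ball)
  define r where "r = min r1 r2"
  have r: "r > 0" "ball a r \<subseteq> ball a r1" "ball a r \<subseteq> ball a r2"
    using r1 r2 by (auto simp: r_def)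
  \<comment> \<open>The second argument stands for the conjugate of the first:
    \<open>Q z (cnj z)\<close> is the orthogonal projection onto the kernel of
    \<open>M z\<close>.\<close>
  define Q where "Q = (\<lambda>z w. h z ** matrix_inv (h z + conj_transpose (h (cnj w)) - mat 1))"
  define D where "D = (\<lambda>z w. transpose q ** ((mat 1 - Q z w) ** N1 z ** (mat 1 - transpose (Q z w))) ** q - G z)"
  have D0: "D z (cnj a) = 0" if z: "z \<in> ball a r" for z
  proof -
    have "D z (cnj a) $ i $ j = 0" for i j
    proof (rule polarized_identity[where \<phi> = "\<lambda>z w. D z w $ i $ j", OF _ _ z])
      fix f g :: "complex \<Rightarrow> complex" and T :: "complex set"
      assume T: "open T" and f: "f holomorphic_on T" "f ` T \<subseteq> ball a r"
        and g: "g holomorphic_on T" "g ` T \<subseteq> ball (cnj a) r"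
      have cb: "cnj ` ball (cnj a) r \<subseteq> ball a r"
        by (auto simp: dist_norm) (metis complex_cnj_diff complex_cnj_cnj complex_mod_cnj)
      have hf: "matrix_holomorphic_on (\<lambda>x. h (f x)) T"
        using matrix_holomorphic_compose[OF hhol f(1)] f(2) r(2) by blast
      have "matrix_holomorphic_on (\<lambda>z. conj_transpose (h (cnj z))) (ball (cnj a) r)"
        by (intro matrix_holomorphic_conj_transpose_cnj matrix_holomorphic_on_subset[OF hhol])
          (use cb r(2) in auto)
      then have hg: "matrix_holomorphic_on (\<lambda>x. conj_transpose (h (cnj (g x)))) T"
        using matrix_holomorphic_compose[OF _ g] by blast
      have inv: "invertible (h (f x) + conj_transpose (h (cnj (g x))) - mat 1)" if "x \<in> T" for x
        using that f(2) g(2) cb r(3) by (intro r2(2)) blast+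
      have "matrix_holomorphic_on (\<lambda>x. Q (f x) (g x)) T"
        unfolding Q_def by (intro matrix_holomorphic_intros matrix_holomorphic_inv hf hg inv)
      moreover have "matrix_holomorphic_on (\<lambda>x. N1 (f x)) T" "matrix_holomorphic_on (\<lambda>x. G (f x)) T"
        using f(2) r(2) r1(2)
        by (intro matrix_holomorphic_compose[OF N1hol f(1)] matrix_holomorphic_compose[OF G f(1)]; blast)+
      ultimately have "matrix_holomorphic_on (\<lambda>x. D (f x) (g x)) T"
        unfolding D_def by (intro matrix_holomorphic_intros)
      then show "(\<lambda>x. D (f x) (g x) $ i $ j) holomorphic_on T"
        by (simp add: matrix_holomorphic_on_def)
    next
      fix z assume z: "z \<in> ball a r"
      then have z1: "z \<in> ball a r1" "z \<in> S" using r r1(2) by auto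
      have "pinv (M z) = (mat 1 - Q z (cnj z)) ** N1 z ** (mat 1 - transpose (Q z (cnj z)))"
      proof (rule pinv_of_symmetric_inverse[OF sym N1_sym[OF z1(1)] MNM[OF z1(1)] rel(3)[OF z1(1)]])
        show "h z = mat 1 - N1 z ** M z" by (simp add: h_def)
        show "invertible (h z + conj_transpose (h z) - mat 1)" using z r by (intro r2(2)) auto
      qed (simp add: Q_def)
      then show "D z (cnj z) $ i $ j = 0"
        using eq[OF z1(2)] by (simp add: D_def)
    qed
    then show ?thesis by (simp add: vec_eq_iff)
  qed
  show ?thesis
  proof (rule that[OF r(1)])
    show "ball a r \<subseteq> S" using r r1 by auto
    fix z assume z: "z \<in> ball a r"
    then have z1: "z \<in> ball a r1" "z \<in> S" using r r1(2) by auto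
    show "invertible (N0 ** M z ** (N0 ** M0) + mat 1 - N0 ** M0)"
      using r1(3)[OF z1(1)] by (simp add: Z_def p_def)
    have hh: "h z ** h z = h z" by (simp add: h_def matrix_algebra rel(3)[OF z1(1)])
    \<comment> \<open>Frozen at \<open>a\<close>, the conjugate factor is \<open>1 - p\<close>, and
      \<open>h z ** p = 0\<close>. So \<open>Q z (cnj a)\<close> is \<open>h z\<close> itself, and
      the factors around \<open>N1 z\<close> disappear because
      \<open>N1 z ** M z ** N1 z = N1 z\<close>.\<close>
    have k: "h z ** (h z + conj_transpose (h a) - mat 1) = h z"
      by (simp add: hh ha conj_transpose_diff mp(3) matrix_add_ldistrib matrix_diff_ldistrib)
         (simp add: h_def matrix_algebra rel(1)[OF z1(1)])
    have "invertible (h z + conj_transpose (h a) - mat 1)"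
      using z r r2(1) by (intro r2(2)) auto
    then have "Q z (cnj a) = h z"
      unfolding Q_def by (metis k complex_cnj_cnj matrix_inv_right matrix_mul_assoc matrix_mul_rid)
    moreover have "(mat 1 - h z) ** N1 z = N1 z"
      by (simp add: h_def rel(3)[OF z1(1)])
    moreover from this have "N1 z ** (mat 1 - transpose (h z)) = N1 z"
      using N1_sym[OF z1(1)] by (metis matrix_transpose_mul transpose_diff transpose_mat)
    ultimately show "transpose q ** (matrix_inv (N0 ** M z ** (N0 ** M0) + mat 1 - N0 ** M0) ** N0) ** q = G z"
      using D0[OF z] by (simp add: D_def N1_def Z_def p_def)
  qed (rule mp(2))
qed

section \<open>Realizations of rational matrix functions\<close>

text \<open>The resolvent identity \<open>Y' - Y = Y' ** u ** K ** v ** Y\<close>, placed between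
  \<open>v\<close> and \<open>u\<close>.\<close>

lemma woodbury:
  fixes u :: "complex^'c^'n" and v :: "complex^'n^'c" and K :: "complex^'c^'c"
  assumes XY: "X ** Y = mat 1" "Y ** X = mat 1" and XY': "X' ** Y' = mat 1" "Y' ** X' = mat 1"
    and X': "X' = X - u ** K ** v"
  shows "(mat 1 + v ** Y' ** u ** K) ** (v ** Y ** u) = v ** Y' ** u"
    "(mat 1 + v ** Y' ** u ** K) ** (mat 1 - v ** Y ** u ** K) = mat 1"
proof -
  have "Y' ** (u ** K ** v) ** Y = Y' ** (X - X') ** Y" by (simp add: X')
  also have "\<dots> = Y' ** (X ** Y) - (Y' ** X') ** Y"
    by (simp only: matrix_algebra)
  also have "\<dots> = Y' - Y" by (simp add: XY XY')
  finally have "Y' ** u ** K ** v ** Y = Y' - Y" by (simp add: matrix_mul_assoc)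
  then have "v ** (Y' ** u ** K ** v ** Y) ** u = v ** (Y' - Y) ** u" by simp
  then have *: "v ** Y' ** u ** K ** v ** Y ** u = v ** Y' ** u - v ** Y ** u"
    by (simp only: matrix_algebra)
  then show 1: "(mat 1 + v ** Y' ** u ** K) ** (v ** Y ** u) = v ** Y' ** u"
    by (simp add: matrix_algebra)
  have "(mat 1 + v ** Y' ** u ** K) ** (mat 1 - v ** Y ** u ** K) =
      mat 1 + v ** Y' ** u ** K - (mat 1 + v ** Y' ** u ** K) ** (v ** Y ** u) ** K"
    by (simp add: matrix_algebra)
  then show "(mat 1 + v ** Y' ** u ** K) ** (mat 1 - v ** Y ** u ** K) = mat 1"
    by (simp add: 1)
qed

text \<open>Writing \<open>G\<close> for the common value and \<open>R = v X\<^sup>-\<^sup>1 u\<close>, the factor \<open>1 + G K\<close> is invertible and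
  \<open>(1 + G K) R = G\<close>, so that \<open>R\<close> depends on \<open>G\<close> and \<open>K\<close> only.\<close>

lemma woodbury_unique:
  fixes u :: "complex^'c^'n" and v :: "complex^'n^'c" and K :: "complex^'c^'c"
    and u2 :: "complex^'c^'m" and v2 :: "complex^'m^'c"
  assumes inv: "invertible X" "invertible (X - u ** K ** v)" "invertible (X2 - u2 ** K ** v2)"
    and eq: "v ** matrix_inv (X - u ** K ** v) ** u = v2 ** matrix_inv (X2 - u2 ** K ** v2) ** u2"
  shows "invertible X2" "v ** matrix_inv X ** u = v2 ** matrix_inv X2 ** u2"
proof -
  let ?X' = "X - u ** K ** v" and ?X2' = "X2 - u2 ** K ** v2"
  define G where "G = v ** matrix_inv ?X' ** u"
  have G2: "G = v2 ** matrix_inv ?X2' ** u2" by (simp add: G_def eq)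
  note inverses = matrix_inv_right matrix_inv_left
  note 1 = woodbury[OF inverses[OF inv(1)] inverses[OF inv(2)] refl, folded G_def]
  have invG: "\<exists>B. B ** (mat 1 + G ** K) = mat 1"
    using 1(2) by (meson matrix_left_right_inverse)
  \<comment> \<open>The invertibility of \<open>1 + G K\<close> is known from the first realization.
    A kernel vector \<open>w\<close> of \<open>X2\<close> satisfies
    \<open>(1 + G K) v2 w = 0\<close>, so \<open>v2 w\<close> vanishes; then \<open>w\<close> is in
    the kernel of the perturbed matrix too.\<close>
  have "w = 0" if w: "X2 *v w = 0" for w
  proof -
    have w': "?X2' *v w = - ((u2 ** K ** v2) *v w)"
      by (simp add: matrix_vector_mult_diff_rdistrib w)
    have "w = (matrix_inv ?X2' ** ?X2') *v w" by (simp add: inverses inv)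
    also have "\<dots> = - (matrix_inv ?X2' *v ((u2 ** K ** v2) *v w))"
      by (simp only: w' matrix_vector_mul_assoc[symmetric] vec.neg)
    finally have w2: "w = - (matrix_inv ?X2' *v ((u2 ** K ** v2) *v w))" .
    then have "v2 *v w = - (v2 *v (matrix_inv ?X2' *v ((u2 ** K ** v2) *v w)))"
      by (metis vec.neg)
    also have "\<dots> = - ((G ** K) *v (v2 *v w))"
      by (simp add: G2 matrix_vector_mul_assoc matrix_mul_assoc)
    finally have "(mat 1 + G ** K) *v (v2 *v w) = 0"
      by (simp add: matrix_vector_mult_add_rdistrib flip: eq_neg_iff_add_eq_0)
    then have "v2 *v w = 0"
      using invG by (metis matrix_left_invertible_ker)
    then have "(u2 ** K ** v2) *v w = 0"
      by (simp flip: matrix_vector_mul_assoc)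
    then show "w = 0" using w2 by simp
  qed
  then show inv2: "invertible X2"
    by (simp add: invertible_left_inverse matrix_left_invertible_ker)
  have "(mat 1 + G ** K) ** (v2 ** matrix_inv X2 ** u2) = G"
    unfolding G2 by (rule woodbury(1)[OF inverses[OF inv2] inverses[OF inv(3)] refl])
  with 1(1) invG show "v ** matrix_inv X ** u = v2 ** matrix_inv X2 ** u2"
    by (metis matrix_mul_assoc matrix_mul_lid)
qed

section \<open>Polynomial determinants and the count of poles\<close>

lemma poly_det: "poly (det M) x = det (\<chi> i j. poly (M $ i $ j) x)"
  for M :: "'a::comm_ring_1 poly^'n^'n"
  by (simp add: det_def poly_sum poly_prod)

lemma degree_det_le:
  fixes M :: "'a::idom poly^'n^'n"
  assumes "\<And>i j. degree (M $ i $ j) \<le> k"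
  shows "degree (det M) \<le> k * CARD('n)"
  unfolding det_def
proof (rule degree_sum_le)
  fix p :: "'n \<Rightarrow> 'n"
  have "degree (\<Prod>i\<in>UNIV. M $ i $ p i) \<le> (\<Sum>i\<in>UNIV. degree (M $ i $ p i))"
    using degree_prod_sum_le[of UNIV "\<lambda>i. M $ i $ p i"] by (simp add: o_def)
  also have "\<dots> \<le> (\<Sum>i\<in>(UNIV :: 'n set). k)" by (intro sum_mono assms)
  finally have "degree (\<Prod>i\<in>UNIV. M $ i $ p i) \<le> k * CARD('n)" by (simp add: mult.commute)
  then show "degree (of_int (sign p) * (\<Prod>i\<in>UNIV. M $ i $ p i)) \<le> k * CARD('n)"
    by (simp add: sign_def)
qed (simp add: finite_permutations)

lemma poly_eq_if_infinite:
  fixes p q :: "'a::idom poly"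
  assumes "infinite U" "\<And>x. x \<in> U \<Longrightarrow> poly p x = poly q x"
  shows "p = q"
proof (rule ccontr)
  assume "p \<noteq> q"
  then have "finite {x. poly (p - q) x = 0}" by (intro poly_roots_finite) simp
  moreover have "U \<subseteq> {x. poly (p - q) x = 0}" using assms(2) by auto
  ultimately show False using assms(1) finite_subset by blast
qed

text \<open>Clearing denominators gives a polynomial identity, as it holds on an infinite set. At
  \<open>e l\<close> the right side vanishes, and on the left only the summand with the residue
  \<open>w c l\<close> survives, so the determinant of the pencil vanishes there. Its degree is at
  most the size of the pencil. The channel \<open>c\<close> may depend on \<open>l\<close>.\<close>

lemma card_poles_le:
  fixes A B :: "complex^'s^'s" and e :: "'l::finite \<Rightarrow> complex" and w :: "'c \<Rightarrow> 'l \<Rightarrow> complex"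
  assumes e: "inj e" and w: "\<And>l. \<exists>c. w c l \<noteq> 0" and U: "infinite U"
    and inv: "\<And>z. z \<in> U \<Longrightarrow> invertible (A + mat z ** B)"
    and poles: "\<And>z. z \<in> U \<Longrightarrow> z \<notin> range e"
    and eq: "\<And>z c. z \<in> U \<Longrightarrow> (\<Sum>l\<in>UNIV. w c l / (e l - z)) =
      (\<Sum>i\<in>UNIV. \<Sum>j\<in>UNIV. x c i j * matrix_inv (A + mat z ** B) $ i $ j)"
  shows "CARD('l) \<le> CARD('s)"
proof -
  define M :: "complex poly^'s^'s" where "M = (\<chi> i j. [:A $ i $ j, B $ i $ j:])"
  \<comment> \<open>Cramer numerators: \<open>N i j / det M\<close> is the entry of the inverse
    pencil.\<close>
  define N :: "'s \<Rightarrow> 's \<Rightarrow> complex poly" where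
    "N = (\<lambda>i j. det (\<chi> r c. if c = i then mat 1 $ r $ j else M $ r $ c))"
  have entry: "(A + mat z ** B) $ i $ j = A $ i $ j + z * B $ i $ j" for z i j
    by (simp add: matrix_matrix_mult_def mat_def if_distrib if_distribR cong: if_cong)
  have det_eq: "poly (det M) z = det (A + mat z ** B)" for z
    unfolding poly_det by (rule arg_cong[of _ _ det]) (simp add: vec_eq_iff M_def entry del: vector_add_component)
  have one: "poly ((mat 1 :: complex poly^'s^'s) $ i $ j) z = mat 1 $ i $ j" for z i j
    by (simp add: mat_def)
  have N_eq: "poly (N i j) z = det (\<chi> r c. if c = i then mat 1 $ r $ j else (A + mat z ** B) $ r $ c)" for i j z
    unfolding N_def poly_det
    by (rule arg_cong[of _ _ det]) (simp add: vec_eq_iff M_def entry one del: vector_add_component)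
  have det_nz: "poly (det M) z \<noteq> 0" if "z \<in> U" for z
    using inv[OF that] by (simp add: det_eq invertible_det_nz)
  then have M0: "det M \<noteq> 0" using U by (metis all_not_in_conv finite.emptyI poly_0)
  let ?P = "\<lambda>S. \<Prod>m\<in>S. [:e m, - 1:]"
  have root: "poly (det M) (e l) = 0" for l
  proof -
    obtain c where c: "w c l \<noteq> 0" using w by blast
    have "det M * (\<Sum>l\<in>UNIV. smult (w c l) (?P (UNIV - {l}))) =
        (\<Sum>i\<in>UNIV. \<Sum>j\<in>UNIV. smult (x c i j) (N i j)) * ?P UNIV"
    proof (rule poly_eq_if_infinite[OF U])
      fix z assume z: "z \<in> U"
      then have nz: "e l - z \<noteq> 0" for l using poles by auto
      have "poly (\<Sum>l\<in>UNIV. smult (w c l) (?P (UNIV - {l}))) z =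
          (\<Sum>l\<in>UNIV. w c l / (e l - z) * poly (?P UNIV) z)"
        unfolding poly_sum
      proof (rule sum.cong[OF refl])
        fix l
        have "poly (?P UNIV) z = (e l - z) * poly (?P (UNIV - {l})) z"
          by (simp add: poly_prod prod.remove[of UNIV l] left_diff_distrib)
        then show "poly (smult (w c l) (?P (UNIV - {l}))) z = w c l / (e l - z) * poly (?P UNIV) z"
          using nz[of l] by simp
      qed
      also have "\<dots> = (\<Sum>l\<in>UNIV. w c l / (e l - z)) * poly (?P UNIV) z"
        by (simp add: sum_distrib_right)
      finally have L: "poly (\<Sum>l\<in>UNIV. smult (w c l) (?P (UNIV - {l}))) z =
          (\<Sum>l\<in>UNIV. w c l / (e l - z)) * poly (?P UNIV) z" .
      have "poly (\<Sum>i\<in>UNIV. \<Sum>j\<in>UNIV. smult (x c i j) (N i j)) z =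
          poly (det M) z * (\<Sum>l\<in>UNIV. w c l / (e l - z))"
        using det_nz[OF z] unfolding eq[OF z] matrix_inv_nth[OF inv[OF z]] det_eq[symmetric] N_eq[symmetric]
        by (simp add: poly_sum sum_distrib_left)
      then show "poly (det M * (\<Sum>l\<in>UNIV. smult (w c l) (?P (UNIV - {l})))) z =
          poly ((\<Sum>i\<in>UNIV. \<Sum>j\<in>UNIV. smult (x c i j) (N i j)) * ?P UNIV) z"
        by (simp only: poly_mult L mult.assoc)
    qed
    from arg_cong[OF this, of "\<lambda>p. poly p (e l)"]
    have "poly (det M) (e l) * (\<Sum>k\<in>UNIV. w c k * (\<Prod>m\<in>UNIV - {k}. e m - e l)) = 0"
      by (simp add: poly_sum poly_prod prod.remove[of UNIV l])
    moreover have "(\<Sum>k\<in>UNIV. w c k * (\<Prod>m\<in>UNIV - {k}. e m - e l)) =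
        w c l * (\<Prod>m\<in>UNIV - {l}. e m - e l)"
      by (subst sum.remove[of UNIV l]) (auto intro!: sum.neutral, blast)
    moreover have "(\<Prod>m\<in>UNIV - {l}. e m - e l) \<noteq> 0"
      using e by (auto simp: inj_def)
    ultimately show ?thesis using c by simp
  qed
  have "CARD('l) = card (range e)" using e by (simp add: card_image)
  also have "\<dots> \<le> card {z. poly (det M) z = 0}"
    using root by (intro card_mono poly_roots_finite M0) auto
  also have "\<dots> \<le> degree (det M)" by (rule card_poly_roots_bound[OF M0])
  also have "\<dots> \<le> 1 * CARD('s)" by (rule degree_det_le) (simp add: M_def)
  finally show ?thesis by simp
qed

section \<open>Scattering matrices\<close>

lemma diag_mat_mult: "diag_mat u ** diag_mat v = diag_mat (\<lambda>i. u i * v i)"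
proof -
  have "(\<Sum>k\<in>UNIV. (if i = k then u i else 0) * (if k = j then v k else 0)) =
      (\<Sum>k\<in>UNIV. if k = i then (if i = j then u i * v i else 0) else 0)" for i j
    by (rule sum.cong) auto
  then show ?thesis by (simp add: diag_mat_def matrix_matrix_mult_def vec_eq_iff)
qed

lemma diag_mat_const: "diag_mat (\<lambda>i. z) = mat z"
  by (simp add: diag_mat_def mat_def)

lemma diag_mat_diff: "diag_mat u - diag_mat v = diag_mat (\<lambda>i. u i - v i)"
  by (simp add: diag_mat_def vec_eq_iff)

lemma transpose_diag_mat [simp]: "transpose (diag_mat u) = diag_mat u"
  by (auto simp: diag_mat_def transpose_def vec_eq_iff)

lemma diag_mat_inverse:
  assumes "\<And>i. u i \<noteq> 0"
  shows "diag_mat u ** diag_mat (\<lambda>i. inverse (u i)) = mat 1"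
    "diag_mat (\<lambda>i. inverse (u i)) ** diag_mat u = mat 1"
  using assms by (simp_all add: diag_mat_mult diag_mat_const)

lemma invertible_diag_mat: "(\<And>i. u i \<noteq> 0) \<Longrightarrow> invertible (diag_mat u)"
  using diag_mat_inverse[of u] by (auto simp: invertible_def)

lemma matrix_inv_diag_mat: "(\<And>i. u i \<noteq> 0) \<Longrightarrow> matrix_inv (diag_mat u) = diag_mat (\<lambda>i. inverse (u i))"
  by (intro matrix_inv_eq diag_mat_inverse) auto

lemma diag_mat_mult_vec: "diag_mat u *v x = (\<chi> i. u i * x $ i)"
proof -
  have "(\<Sum>j\<in>UNIV. (if i = j then u i else 0) * x $ j) = (\<Sum>j\<in>UNIV. if j = i then u i * x $ i else 0)" for i
    by (rule sum.cong) auto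
  then show ?thesis by (simp add: diag_mat_def matrix_vector_mult_def vec_eq_iff)
qed

lemma diag_mat_mult_nth: "(diag_mat u ** A) $ i $ j = u i * A $ i $ j"
proof -
  have "(\<Sum>k\<in>UNIV. (if i = k then u i else 0) * A $ k $ j) = (\<Sum>k\<in>UNIV. if k = i then u i * A $ i $ j else 0)"
    by (rule sum.cong) auto
  then show ?thesis by (simp add: diag_mat_def matrix_matrix_mult_def)
qed

lemma mult_mat_commute: "A ** mat z = mat z ** (A :: 'a::comm_semiring_1^'n^'m)"
proof -
  have "(\<Sum>k\<in>UNIV. A $ i $ k * (if k = j then z else 0)) = (\<Sum>k\<in>UNIV. if k = j then z * A $ i $ j else 0)"
    "(\<Sum>k\<in>UNIV. (if i = k then z else 0) * A $ k $ j) = (\<Sum>k\<in>UNIV. if k = i then z * A $ i $ j else 0)" for i j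
    by (rule sum.cong; auto simp: mult.commute)+
  then show ?thesis by (simp add: mat_def matrix_matrix_mult_def vec_eq_iff)
qed

lemma matrix_holomorphic_diag_mat:
  assumes "\<And>i. (\<lambda>z. u z i) holomorphic_on S"
  shows "matrix_holomorphic_on (\<lambda>z. diag_mat (u z)) S"
  unfolding matrix_holomorphic_on_def
proof (intro allI)
  fix i j
  show "(\<lambda>z. diag_mat (u z) $ i $ j) holomorphic_on S"
    using assms by (cases "i = j") (simp_all add: diag_mat_def)
qed

text \<open>As \<open>rows A\<close> is a set, repeated rows must first be excluded by counting;
  only then does independence of the set give independence of the family of rows.\<close>

lemma matrix_right_inverse_if_full_rank:
  fixes A :: "'a::field^'n^'m"
  assumes "rank A = CARD('m)"
  obtains B where "A ** B = mat 1"
proof -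
  have rows: "rows A = range (\<lambda>i. row i A)" by (auto simp: rows_def)
  have "vec.dim (rows A) \<le> card (rows A)"
    by (simp add: rows vec.dim_le_card')
  moreover have "card (rows A) \<le> CARD('m)"
    unfolding rows by (rule card_image_le) simp
  ultimately have card: "card (rows A) = CARD('m)" "vec.dim (rows A) = card (rows A)"
    using assms by (simp_all add: row_rank_def_gen)
  then have inj: "inj (\<lambda>i. row i A)"
    unfolding rows by (intro eq_card_imp_inj_on) auto
  have indep: "vec.independent (rows A)"
    using card by (intro vec.card_le_dim_spanning[OF order_refl vec.span_superset]) (simp_all add: rows)
  have "c i = 0" if "(\<Sum>i\<in>UNIV. c i *s row i A) = 0" for c i
  proof -
    let ?g = "inv (\<lambda>i. row i A)"
    have "(\<Sum>v\<in>rows A. c (?g v) *s v) = (\<Sum>i\<in>UNIV. c i *s row i A)"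
      unfolding rows by (simp add: sum.reindex[OF inj] inv_f_f[OF inj])
    then have "c (?g (row i A)) = 0"
      using vec.independentD[OF indep _ order_refl, of "\<lambda>v. c (?g v)" "row i A"] that
      by (auto simp: rows)
    then show ?thesis by (simp add: inv_f_f[OF inj])
  qed
  then have "\<exists>B. A ** B = mat 1"
    unfolding matrix_right_invertible_independent_rows by simp
  then show ?thesis using that by (elim exE)
qed

text \<open>For a kernel vector \<open>v\<close>, pair the equation with the conjugate of
  \<open>v\<close>. The diagonal part is real, so the imaginary part leaves a sum of
  \<open>Im (K c)\<close> times the squared moduli of the components of
  \<open>transpose \<Gamma> *v v\<close>. These components vanish, and then so does
  \<open>v\<close>.\<close>

lemma invertible_dissipative:
  fixes \<Gamma> :: "complex^'c^'l"
  assumes e: "\<And>l. e l \<noteq> (0 :: real)" and K: "\<And>c. Im (K c) > 0"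
    and \<Gamma>: "\<And>l c. cnj (\<Gamma> $ l $ c) = \<Gamma> $ l $ c"
  shows "invertible (diag_mat (\<lambda>l. of_real (e l)) - \<Gamma> ** diag_mat K ** transpose \<Gamma>)"
    (is "invertible ?X")
proof -
  have "v = 0" if v: "?X *v v = 0" for v
  proof -
    define u where "u = transpose \<Gamma> *v v"
    have cu: "cnj (u $ c) = (\<Sum>l\<in>UNIV. \<Gamma> $ l $ c * cnj (v $ l))" for c
      by (simp add: u_def transpose_def matrix_vector_mult_def \<Gamma> del: transpose_matrix_vector)
    have Xv: "diag_mat (\<lambda>l. of_real (e l)) *v v = \<Gamma> *v (diag_mat K *v u)"
      using v by (simp add: u_def matrix_vector_mult_diff_rdistrib matrix_vector_mul_assoc
          matrix_mul_assoc del: transpose_matrix_vector)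
    have "(\<Sum>l\<in>UNIV. of_real (e l) * (v $ l * cnj (v $ l))) =
        (\<Sum>l\<in>UNIV. (diag_mat (\<lambda>l. of_real (e l)) *v v) $ l * cnj (v $ l))"
      by (simp add: diag_mat_mult_vec mult.assoc)
    also have "\<dots> = (\<Sum>l\<in>UNIV. \<Sum>c\<in>UNIV. K c * u $ c * (\<Gamma> $ l $ c * cnj (v $ l)))"
      unfolding Xv by (simp add: diag_mat_mult_vec)
        (simp add: matrix_vector_mult_def sum_distrib_right sum_distrib_left mult_ac)
    also have "\<dots> = (\<Sum>c\<in>UNIV. K c * (u $ c * cnj (u $ c)))"
      by (subst sum.swap) (simp add: cu sum_distrib_left mult.assoc)
    finally have "(\<Sum>l\<in>UNIV. of_real (e l) * (v $ l * cnj (v $ l))) =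
        (\<Sum>c\<in>UNIV. K c * (u $ c * cnj (u $ c)))" .
    then have "Im (\<Sum>l\<in>UNIV. of_real (e l) * (v $ l * cnj (v $ l))) =
        Im (\<Sum>c\<in>UNIV. K c * (u $ c * cnj (u $ c)))" by simp
    then have "0 = (\<Sum>c\<in>UNIV. Im (K c) * (cmod (u $ c))\<^sup>2)"
      by (simp add: complex_norm_square[symmetric])
    then have "\<forall>c\<in>UNIV. Im (K c) * (cmod (u $ c))\<^sup>2 = 0"
      using sum_nonneg_eq_0_iff[of UNIV "\<lambda>c. Im (K c) * (cmod (u $ c))\<^sup>2"] K
      by (simp add: less_imp_le)
    then have "u = 0" using K by (simp add: vec_eq_iff) (metis less_irrefl)
    then have "diag_mat (\<lambda>l. of_real (e l)) *v v = 0" by (simp add: Xv)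
    then show "v = 0" using e by (simp add: diag_mat_mult_vec vec_eq_iff)
  qed
  then show ?thesis
    by (simp add: invertible_left_inverse matrix_left_invertible_ker)
qed

text \<open>At real wave numbers the Wronskian relation is \<open>Im (O' * cnj O) = 1\<close>.\<close>

lemma chan_L_dissipative:
  assumes "rmatrix_data d" "x > 0"
  shows "chan_O d c (of_real x) \<noteq> 0" "Im (chan_L d c (of_real x)) > 0"
proof -
  let ?\<rho> = "complex_of_real x"
  define k where "k = wave_number d c ?\<rho>"
  define f where "f = outgoing d c k"
  have r: "radius d c > 0" and wf: "wave_functions d c"
    using assms(1) by (auto simp: rmatrix_data_def)
  have k: "k \<noteq> 0" "cnj k = k" "?\<rho> = k * of_real (radius d c)"
    using r assms(2) by (simp_all add: k_def wave_number_def)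
  have inc: "incoming d c k = cnj \<circ> f \<circ> cnj"
    by (simp add: fun_eq_iff incoming_def f_def k(2))
  have wr: "deriv f ?\<rho> * incoming d c k ?\<rho> - deriv (incoming d c k) ?\<rho> * f ?\<rho> = 2 * \<i>"
    and "f analytic_on {k * of_real r |r. r > 0}"
    using wf r k unfolding wave_functions_def f_def radial_solution_def Let_def by auto
  then have "f analytic_on {?\<rho>}"
    using r k(3) by (auto elim!: analytic_on_subset)
  then have "(f has_field_derivative deriv f ?\<rho>) (at ?\<rho>)"
    by (simp add: analytic_on_imp_differentiable_at DERIV_deriv_iff_field_differentiable)
  then have "(incoming d c k has_field_derivative cnj (deriv f ?\<rho>)) (at ?\<rho>)"
    unfolding inc using has_field_derivative_cnj_cnj[of f "deriv f ?\<rho>" ?\<rho>] by simp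
  then have "deriv f ?\<rho> * cnj (f ?\<rho>) - cnj (deriv f ?\<rho>) * f ?\<rho> = 2 * \<i>"
    using wr by (simp add: DERIV_imp_deriv) (simp add: inc)
  then have "Im (deriv f ?\<rho> * cnj (f ?\<rho>) - cnj (deriv f ?\<rho>) * f ?\<rho>) = 2"
    by simp
  then have im: "Im (deriv f ?\<rho> * cnj (f ?\<rho>)) = 1"
    by (simp add: algebra_simps)
  then have "f ?\<rho> \<noteq> 0" by auto
  then show "chan_O d c ?\<rho> \<noteq> 0" by (simp add: chan_O_def f_def k_def)
  have "chan_L d c ?\<rho> = of_real (x / (cmod (f ?\<rho>))\<^sup>2) * (deriv f ?\<rho> * cnj (f ?\<rho>))"
    unfolding of_real_divide complex_norm_square using \<open>f ?\<rho> \<noteq> 0\<close>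
    by (simp add: chan_L_def chan_O_def flip: k_def f_def)
  then have "Im (chan_L d c ?\<rho>) = x / (cmod (f ?\<rho>))\<^sup>2 * 1"
    using im by (simp only: times_complex.sel Re_complex_of_real Im_complex_of_real)
  then show "Im (chan_L d c ?\<rho>) > 0" using assms(2) \<open>f ?\<rho> \<noteq> 0\<close> by simp
qed

section \<open>The level matrix near a regular energy\<close>

definition chan_K :: "('l::finite, 'c::finite) rmatrix \<Rightarrow> 'c sheet \<Rightarrow> complex \<Rightarrow> 'c \<Rightarrow> complex" where
  "chan_K d s E c = chan_L d c (rho d s E c) - of_real (boundary d c)"

lemma level_matrix_inv_eq:
  "level_matrix_inv d s E = diag_mat (\<lambda>l. of_real (res_energy d l) - E)
     - width_mat d ** diag_mat (chan_K d s E) ** transpose (width_mat d)"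
  unfolding level_matrix_inv_def diag_mat_diff chan_K_def[abs_def] diag_mat_const[symmetric] ..

lemma transpose_level_matrix_inv: "transpose (level_matrix_inv d s E) = level_matrix_inv d s E"
  by (simp add: level_matrix_inv_eq transpose_diff matrix_transpose_mul matrix_mul_assoc)

text \<open>All factors around \<open>G\<close> are invertible at such an energy, which reduces
  equality of scattering matrices to equality of their inner parts.\<close>

lemma scattering_of_inject:
  fixes d :: "('l::finite, 'c::finite) rmatrix"
  assumes "\<And>c. rho d s E c \<noteq> 0" "\<And>c. chan_O d c (rho d s E c) \<noteq> 0"
    and eq: "scattering_of d s E G = scattering_of d s E H"
  shows "G = H"
proof -
  define P where "P = matrix_inv (diag_mat (\<lambda>c. chan_O d c (rho d s E c)))"
  define r where "r = diag_mat (\<lambda>c. csqrt (rho d s E c))"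
  obtain P' where P': "P' ** P = mat 1" "P ** P' = mat 1"
    unfolding P_def using matrix_inv_left matrix_inv_right invertible_diag_mat assms(2) by metis
  obtain r' where r': "r' ** r = mat 1" "r ** r' = mat 1"
    using invertible_diag_mat[of "\<lambda>c. csqrt (rho d s E c)"] assms(1)
    by (auto simp: invertible_def r_def)
  obtain t where t: "t ** mat (2 * \<i>) = (mat 1 :: complex^'c^'c)"
    using diag_mat_inverse(2)[of "\<lambda>_. 2 * \<i>"] by (auto simp: diag_mat_const)
  have "mat (2 * \<i>) ** (r ** P ** G ** P ** r) = mat (2 * \<i>) ** (r ** P ** H ** P ** r)"
    using eq by (simp add: scattering_of_def Let_def P_def r_def)
  then have "t ** mat (2 * \<i>) ** (r ** P ** G ** P ** r) = t ** mat (2 * \<i>) ** (r ** P ** H ** P ** r)"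
    by (metis matrix_mul_assoc)
  then have "r ** P ** G ** P ** r = r ** P ** H ** P ** r" by (simp add: t)
  then have "P' ** (r' ** (r ** P ** G ** P ** r) ** r') ** P' =
      P' ** (r' ** (r ** P ** H ** P ** r) ** r') ** P'" by simp
  moreover have "P' ** (r' ** (r ** P ** X ** P ** r) ** r') ** P' =
      (P' ** ((r' ** r) ** P)) ** X ** (P ** (r ** r') ** P')" for X
    by (simp add: matrix_mul_assoc)
  ultimately show ?thesis by (simp add: P' r')
qed

lemma holomorphic_rho:
  assumes "\<And>z. z \<in> S \<Longrightarrow> Re z > threshold d c"
  shows "(\<lambda>z. rho d s z c) holomorphic_on S"
  unfolding rho_def
  by (intro holomorphic_intros) (force dest: assms simp: complex_nonpos_Reals_iff)

text \<open>The square of the root has positive real part, so the root is not imaginary, and the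
  principal branch selects the right half-plane. That is where the outgoing waves are holomorphic in
  the wave number.\<close>

lemma Re_rho_pos:
  assumes "rho0 d c > 0" "Re z > threshold d c"
  shows "Re (rho d (\<lambda>_. True) z c) > 0"
proof -
  define w where "w = csqrt (z - of_real (threshold d c))"
  have "(Re w)\<^sup>2 - (Im w)\<^sup>2 = Re (w\<^sup>2)"
    by (simp add: power2_eq_square)
  also have "\<dots> > 0" using assms(2) by (simp add: w_def)
  finally have "Re w \<noteq> 0"
    using zero_le_power2[of "Im w"] by auto
  then have "Re (csqrt (z - of_real (threshold d c))) > 0"
    using Re_csqrt[of "z - of_real (threshold d c)"] by (simp add: w_def)
  then show ?thesis using assms(1) by (simp add: rho_def)
qed

lemma physical_sheet_holomorphic:
  fixes d :: "('l::finite, 'c::finite) rmatrix" and s :: "'c sheet"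
  assumes data: "rmatrix_data d" and s: "s = (\<lambda>_. True)"
  obtains S where "open S" "S \<noteq> {}" "\<And>z. z \<in> S \<Longrightarrow> regular_energy d s z"
    "matrix_holomorphic_on (level_matrix_inv d s) S"
proof -
  define T where "T = {z. \<forall>c. Re z > threshold d c}"
  have "T = (\<Inter>c. {z. Re z > threshold d c})" by (auto simp: T_def)
  then have openT: "open T" by (simp add: open_INT open_halfspace_Re_gt)
  have r: "radius d c > 0" "rho0 d c > 0" "wave_functions d c" for c
    using data by (auto simp: rmatrix_data_def)
  have rho_hol: "(\<lambda>z. rho d s z c) holomorphic_on T" for c
    by (rule holomorphic_rho) (simp add: T_def)
  have Re_rho: "Re (rho d s z c) > 0" if "z \<in> T" for z c
    unfolding s using that r by (intro Re_rho_pos) (simp_all add: T_def)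
  let ?k = "\<lambda>c z. wave_number d c (rho d s z c)"
  have k: "?k c holomorphic_on T" "?k c ` T \<subseteq> {k. Re k > 0}" for c
    unfolding wave_number_def using r(1)[of c] Re_rho
    by (auto intro!: holomorphic_intros rho_hol)
  have k_radius: "?k c z * of_real (radius d c) = rho d s z c" for c z
    using r(1)[of c] by (simp add: wave_number_def)
  have hol: "(\<lambda>k. outgoing d c k (k * of_real (radius d c))) holomorphic_on {k. Re k > 0}"
    "(\<lambda>k. deriv (outgoing d c k) (k * of_real (radius d c))) holomorphic_on {k. Re k > 0}" for c
    using r(1,3)[of c] by (auto simp: wave_functions_def)
  have O_hol: "(\<lambda>z. chan_O d c (rho d s z c)) holomorphic_on T" for c
    using holomorphic_on_compose_gen[OF k(1)[of c] hol(1)[of c] k(2)[of c]] by (simp add: o_def k_radius chan_O_def)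
  have O'_hol: "(\<lambda>z. deriv (outgoing d c (?k c z)) (rho d s z c)) holomorphic_on T" for c
    using holomorphic_on_compose_gen[OF k(1)[of c] hol(2)[of c] k(2)[of c]] by (simp add: o_def k_radius)
  define S1 where "S1 = (\<Inter>c. {z\<in>T. chan_O d c (rho d s z c) \<noteq> 0})"
  have "open {z\<in>T. chan_O d c (rho d s z c) \<noteq> 0}" for c
    using continuous_open_preimage[OF holomorphic_on_imp_continuous_on[OF O_hol] openT, of "- {0}" c]
    by (simp add: vimage_def Collect_conj_eq[symmetric] Int_def open_Compl)
  then have openS1: "open S1" by (simp add: S1_def open_INT)
  have S1T: "S1 \<subseteq> T" by (auto simp: S1_def)
  have K_hol: "(\<lambda>z. chan_K d s z c) holomorphic_on S1" for c
    unfolding chan_K_def chan_L_def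
    by (intro holomorphic_intros holomorphic_on_subset[OF rho_hol S1T]
        holomorphic_on_subset[OF O_hol S1T] holomorphic_on_subset[OF O'_hol S1T])
      (auto simp: S1_def)
  have lmi_hol: "matrix_holomorphic_on (level_matrix_inv d s) S1"
    unfolding level_matrix_inv_eq[abs_def]
    by (intro matrix_holomorphic_intros matrix_holomorphic_diag_mat holomorphic_intros K_hol)
  \<comment> \<open>The energy \<open>t\<close> also exceeds the resonance energies, so that the
    diagonal \<open>res_energy d l - t\<close> has no zero, as \<open>invertible_dissipative\<close>
    requires.\<close>
  define t where "t = Max (range (threshold d) \<union> range (res_energy d)) + 1"
  have t: "threshold d c < t" "res_energy d l < t" for c l
  proof -
    have "threshold d c \<le> t - 1" "res_energy d l \<le> t - 1"
      unfolding t_def add_diff_cancel_right' by (rule Max_ge; simp)+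
    then show "threshold d c < t" "res_energy d l < t" by simp_all
  qed
  have rho_t: "\<exists>x>0. rho d s (of_real t) c = of_real x" for c
    using t(1)[of c] r(2)[of c]
    by (intro exI[of _ "rho0 d c * sqrt (t - threshold d c)"])
      (simp add: rho_def s csqrt_of_real_nonneg flip: of_real_diff)
  have tS1: "of_real t \<in> S1"
  proof -
    have "chan_O d c (rho d s (of_real t) c) \<noteq> 0" for c
      using rho_t[of c] chan_L_dissipative(1)[OF data] by auto
    then show ?thesis using t(1) by (simp add: S1_def T_def)
  qed
  have "invertible (level_matrix_inv d s (of_real t))"
  proof -
    have "Im (chan_K d s (of_real t) c) > 0" for c
      using rho_t[of c] chan_L_dissipative(2)[OF data] by (auto simp: chan_K_def)
    then have "invertible (diag_mat (\<lambda>l. of_real (res_energy d l - t)) -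
        width_mat d ** diag_mat (chan_K d s (of_real t)) ** transpose (width_mat d))"
      by (intro invertible_dissipative) (use t(2) in \<open>auto simp: width_mat_def less_imp_neq\<close>)
    then show ?thesis by (simp add: level_matrix_inv_eq)
  qed
  then obtain e where e: "e > 0" "ball (of_real t) e \<subseteq> S1"
    "\<And>z. z \<in> ball (of_real t) e \<Longrightarrow> invertible (level_matrix_inv d s z)"
    using matrix_holomorphic_invertible_ball[OF lmi_hol openS1 tS1] by metis
  have "regular_energy d s z" if "z \<in> ball (of_real t) e" for z
  proof -
    have z: "z \<in> S1" using that e by auto
    then have "Re (rho d s z c) > 0" for c using S1T Re_rho by auto
    then have "rho d s z c \<noteq> 0" for c by (metis less_irrefl zero_complex.sel(1))
    then show ?thesis using z e(3)[OF that] by (auto simp: regular_energy_def S1_def)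
  qed
  then show ?thesis
    using e(1) matrix_holomorphic_on_subset[OF lmi_hol e(2)]
    by (intro that[of "ball (of_real t) e"]) auto
qed

section \<open>The two implications\<close>

lemma reconstructs_if_full_rank:
  assumes "rank (pole_matrix a) = CARD('l)"
  shows "reconstructs_scattering (d :: ('l::finite, 'c::finite) rmatrix) a"
  unfolding reconstructs_scattering_def
proof (intro allI impI)
  fix s E assume reg: "regular_energy d s E"
  let ?a = "pole_matrix a" and ?X = "level_matrix_inv d s E"
  obtain b where b: "?a ** b = mat 1"
    using matrix_right_inverse_if_full_rank[OF assms] .
  then have b': "transpose b ** transpose ?a = mat 1"
    by (metis matrix_transpose_mul transpose_mat)
  let ?M = "transpose ?a ** ?X ** ?a"
  have inv: "invertible ?X" using reg by (simp add: regular_energy_def)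
  have "transpose b ** (?M ** pinv ?M ** ?M) ** b = transpose b ** ?M ** b"
    using is_moore_penrose_pinv[of ?M] by (simp add: is_moore_penrose_def)
  moreover have "transpose b ** (?M ** pinv ?M ** ?M) ** b = (transpose b ** transpose ?a) ** ?X **
      (?a ** pinv ?M ** transpose ?a) ** ?X ** (?a ** b)"
    "transpose b ** ?M ** b = (transpose b ** transpose ?a) ** ?X ** (?a ** b)"
    by (simp_all only: matrix_mul_assoc)
  ultimately have "?X ** (?a ** pinv ?M ** transpose ?a) ** ?X = ?X"
    by (simp add: b b')
  then have "matrix_inv ?X ** (?X ** (?a ** pinv ?M ** transpose ?a) ** ?X) ** matrix_inv ?X =
      matrix_inv ?X ** ?X ** matrix_inv ?X" by simp
  moreover have "matrix_inv ?X ** (?X ** Y ** ?X) ** matrix_inv ?X =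
      (matrix_inv ?X ** ?X) ** Y ** (?X ** matrix_inv ?X)" for Y
    by (simp only: matrix_mul_assoc)
  ultimately have "?a ** pinv ?M ** transpose ?a = level_matrix d s E"
    by (simp add: matrix_inv_left[OF inv] matrix_inv_right[OF inv] level_matrix_def)
  then have "transpose (width_mat d) ** (?a ** pinv ?M ** transpose ?a) ** width_mat d =
      transpose (width_mat d) ** level_matrix d s E ** width_mat d" by simp
  then show "alt_scattering d a s E = scattering d s E"
    by (simp add: alt_scattering_def scattering_def alt_width_def alt_level_matrix_def
        matrix_transpose_mul matrix_mul_assoc)
qed

lemma card_le_if_reconstructs:
  fixes d :: "('l::finite, 'c::finite) rmatrix" and a :: "'s::finite \<Rightarrow> complex^'l"
  assumes data: "rmatrix_data d" and coupled: "\<And>l. \<exists>c. width d $ l $ c \<noteq> 0"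
    and rec: "reconstructs_scattering d a"
  shows "CARD('l) \<le> CARD('s)"
proof -
  define s :: "'c sheet" where "s = (\<lambda>_. True)"
  obtain S where S: "open S" "S \<noteq> {}" and reg: "\<And>z. z \<in> S \<Longrightarrow> regular_energy d s z"
    and hol: "matrix_holomorphic_on (level_matrix_inv d s) S"
    using physical_sheet_holomorphic[OF data s_def] by metis
  define W where "W = width_mat d"
  define \<alpha> where "\<alpha> = pole_matrix a"
  define q where "q = transpose \<alpha> ** W"
  define X where "X = level_matrix_inv d s"
  define M where "M = (\<lambda>z. transpose \<alpha> ** X z ** \<alpha>)"
  define G where "G = (\<lambda>z. transpose W ** matrix_inv (X z) ** W)"
  define e where "e = (\<lambda>l. complex_of_real (res_energy d l))"
  have inv: "invertible (X z)" if "z \<in> S" for z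
    using reg[OF that] by (simp add: regular_energy_def X_def)
  have Mhol: "matrix_holomorphic_on M S"
    unfolding M_def X_def by (intro matrix_holomorphic_intros hol)
  have Msym: "transpose (M z) = M z" for z
    by (simp add: M_def X_def matrix_transpose_mul transpose_level_matrix_inv matrix_mul_assoc)
  have Ghol: "matrix_holomorphic_on G S"
    unfolding G_def by (intro matrix_holomorphic_intros matrix_holomorphic_inv inv)
      (simp_all add: X_def hol)
  have eqG: "transpose q ** pinv (M z) ** q = G z" if "z \<in> S" for z
  proof (rule scattering_of_inject)
    show "scattering_of d s z (transpose q ** pinv (M z) ** q) = scattering_of d s z (G z)"
      using rec reg[OF that] by (simp add: reconstructs_scattering_def alt_scattering_def scattering_def
          alt_width_def alt_level_matrix_def level_matrix_def q_def \<alpha>_def W_def M_def X_def G_def)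
  qed (use reg[OF that] in \<open>auto simp: regular_energy_def\<close>)
  obtain N0 M0 z0 r where r: "r > 0" "ball z0 r \<subseteq> S" and N0: "N0 ** M0 ** N0 = N0"
    and invZ: "\<And>z. z \<in> ball z0 r \<Longrightarrow> invertible (N0 ** M z ** (N0 ** M0) + mat 1 - N0 ** M0)"
    and eqZ: "\<And>z. z \<in> ball z0 r \<Longrightarrow>
       transpose q ** (matrix_inv (N0 ** M z ** (N0 ** M0) + mat 1 - N0 ** M0) ** N0) ** q = G z"
    using holomorphic_compression_of_pinv[OF S Mhol Msym Ghol eqG] by metis
  define p where "p = N0 ** M0"
  \<comment> \<open>The pencil \<open>A + z B\<close> is the relative matrix
    \<open>N0 M p + 1 - p\<close> with the contribution of \<open>L - B\<close> deleted; it is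
    affine in the energy and its size is the number of chosen poles.\<close>
  define A where "A = N0 ** (transpose \<alpha> ** diag_mat e ** \<alpha>) ** p + mat 1 - p"
  define B where "B = 0 - N0 ** (transpose \<alpha> ** \<alpha>) ** p"
  define U where "U = ball z0 r - range e"
  have main: "invertible (A + mat z ** B)"
    "transpose W ** diag_mat (\<lambda>l. inverse (e l - z)) ** W =
      transpose q ** p ** matrix_inv (A + mat z ** B) ** (N0 ** q)" if "z \<in> U" for z
  proof -
    have z: "z \<in> ball z0 r" and ez: "e l - z \<noteq> 0" for l using that by (auto simp: U_def)
    define K where "K = diag_mat (chan_K d s z)"
    have Xz: "X z = diag_mat (\<lambda>l. e l - z) - W ** K ** transpose W"
      by (simp add: X_def level_matrix_inv_eq e_def W_def K_def)
    have "diag_mat (\<lambda>l. e l - z) = diag_mat e - mat z"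
      by (simp add: diag_mat_diff flip: diag_mat_const)
    moreover have "N0 ** (transpose \<alpha> ** mat z ** \<alpha>) ** p = mat z ** (N0 ** (transpose \<alpha> ** \<alpha>) ** p)"
      unfolding mult_mat_commute[of "transpose \<alpha>"] matrix_mul_assoc unfolding mult_mat_commute[of N0] ..
    ultimately have AB: "A + mat z ** B = N0 ** (transpose \<alpha> ** diag_mat (\<lambda>l. e l - z) ** \<alpha>) ** p + mat 1 - p"
      by (simp add: A_def B_def matrix_algebra del: diff_0)
    \<comment> \<open>The deleted contribution has the form \<open>u K v\<close>, with the same
      \<open>K\<close> as in the level matrix.\<close>
    have Z: "N0 ** M z ** p + mat 1 - p = A + mat z ** B - (N0 ** q) ** K ** (transpose q ** p)"
      unfolding AB M_def Xz q_def by (simp add: matrix_transpose_mul matrix_algebra)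
    note invZ' = invZ[OF z, folded p_def]
    \<comment> \<open>Inserting \<open>p\<close> makes the outer left factor
      \<open>transpose q ** p\<close>, equal to the one next to \<open>K\<close> in
      \<open>Z\<close>, as the Woodbury identity demands.\<close>
    have "p ** (matrix_inv (N0 ** M z ** p + mat 1 - p) ** N0) = matrix_inv (N0 ** M z ** p + mat 1 - p) ** N0"
      by (rule relative_inverse(4)[OF N0 p_def refl matrix_inv_right[OF invZ'] matrix_inv_left[OF invZ'] refl])
    then have "G z = (transpose q ** p) ** matrix_inv (N0 ** M z ** p + mat 1 - p) ** (N0 ** q)"
      using eqZ[OF z, folded p_def] by (metis matrix_mul_assoc)
    then have "transpose W ** matrix_inv (diag_mat (\<lambda>l. e l - z) - W ** K ** transpose W) ** W =
       (transpose q ** p) ** matrix_inv (A + mat z ** B - (N0 ** q) ** K ** (transpose q ** p)) ** (N0 ** q)"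
      by (simp only: G_def Xz Z)
    note u = woodbury_unique[OF invertible_diag_mat[OF ez] _ _ this]
    have "invertible (diag_mat (\<lambda>l. e l - z) - W ** K ** transpose W)"
      using inv[of z] r(2) z Xz by auto
    moreover have "invertible (A + mat z ** B - (N0 ** q) ** K ** (transpose q ** p))"
      using invZ' by (simp only: Z)
    ultimately show "invertible (A + mat z ** B)"
      "transpose W ** diag_mat (\<lambda>l. inverse (e l - z)) ** W =
      transpose q ** p ** matrix_inv (A + mat z ** B) ** (N0 ** q)"
      using u matrix_inv_diag_mat[of "\<lambda>l. e l - z"] ez by (simp_all)
  qed
  show ?thesis
  proof (rule card_poles_le)
    show "inj e" using data by (auto simp: e_def rmatrix_data_def inj_def)
    \<comment> \<open>Diagonal channel entries suffice: their residues are, up to sign, squares of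
      widths.\<close>
    show "\<exists>c. (W $ l $ c)\<^sup>2 \<noteq> 0" for l using coupled[of l] by (simp add: W_def width_mat_def)
    have "infinite (ball z0 r)" using uncountable_ball[OF r(1)] countable_finite by blast
    then show "infinite U" by (simp add: U_def)
    show "invertible (A + mat z ** B)" if "z \<in> U" for z by (rule main(1)[OF that])
    show "z \<notin> range e" if "z \<in> U" for z using that by (simp add: U_def)
    show "(\<Sum>l\<in>UNIV. (W $ l $ c)\<^sup>2 / (e l - z)) =
        (\<Sum>i\<in>UNIV. \<Sum>j\<in>UNIV. (transpose q ** p) $ c $ i * (N0 ** q) $ j $ c * matrix_inv (A + mat z ** B) $ i $ j)"
      if "z \<in> U" for z c
    proof -
      have "(\<Sum>l\<in>UNIV. (W $ l $ c)\<^sup>2 / (e l - z)) =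
          (transpose W ** (diag_mat (\<lambda>l. inverse (e l - z)) ** W)) $ c $ c"
        unfolding matrix_matrix_mult_def[of "transpose W"]
        by (simp add: diag_mat_mult_nth transpose_def power2_eq_square divide_inverse mult_ac)
      also have "\<dots> = (transpose q ** p ** matrix_inv (A + mat z ** B) ** (N0 ** q)) $ c $ c"
        using main(2)[OF that] by (simp add: matrix_mul_assoc)
      also have "\<dots> = (\<Sum>i\<in>UNIV. \<Sum>j\<in>UNIV. (transpose q ** p) $ c $ i * (N0 ** q) $ j $ c *
          matrix_inv (A + mat z ** B) $ i $ j)"
        by (rule matrix_mult3_nth)
      finally show ?thesis .
    qed
  qed
qed

text \<open>The assumption \<open>coupled\<close> makes every resonance energy a pole of the
  R-matrix; a level without widths would leave no trace in the scattering matrix. The assumption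
  \<open>generic\<close> is a spanning condition: different solutions may have dependent vectors,
  such as \<open>v\<close> and \<open>- v\<close> at the same energy.\<close>

theorem theorem4:
  fixes d :: "('l::finite, 'c::finite) rmatrix"
    and conv :: shift_convention
    and sh :: "'s::finite \<Rightarrow> 'c sheet"
    and Et :: "'s \<Rightarrow> complex"
    and a :: "'s \<Rightarrow> complex^'l"
  assumes data: "rmatrix_data d"
    and coupled: "\<And>l. \<exists>c. width d $ l $ c \<noteq> 0"
    and poles: "\<And>i. alternative_pole conv d (sh i) (Et i) (a i)"
    and different: "inj (\<lambda>i. (sh i, Et i, a i))"
    and generic: "CARD('s) \<ge> CARD('l) \<Longrightarrow> rank (pole_matrix a) = CARD('l)"
  shows "reconstructs_scattering d a \<longleftrightarrow> CARD('s) \<ge> CARD('l)"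
  using card_le_if_reconstructs[OF data coupled] reconstructs_if_full_rank[OF generic] by blast

end
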